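(* For each admissible triple $(p_0,q_0,r_0)$: (a) there exists a nondoubling metric measure space $\mathfrak Z$ such that $\mathfrak c(p_0,q_0,r,\mathfrak Z)=\infty$ for $r\in[q_0,r_0]$ and $\mathfrak c(p_0,q_0,r,\mathfrak Z)<\infty$ for $r\in(r_0,\infty]$; (b) there exists a nondoubling metric measure space $\mathfrak Z'$ such that $\mathfrak c(p_0,q_0,r,\mathfrak Z')=\infty$ for $r\in[q_0,r_0)$ and $\mathfrak c(p_0,q_0,r,\mathfrak Z')<\infty$ for $r\in[r_0,\infty]$.
   Context: Metric measure space $(X,\rho,\mu)$: nonempty set, metric, nonnegative Borel measure, every open ball of positive finite measure; doubling means $\mu(B(x,2s))\le C\mu(B(x,s))$ uniformly. Lorentz quasinorm: $d_f(t)=\mu(\{|f|>t\})$, $\|f\|_{p,q}=p^{1/q}(\int_0^\infty(t d_f(t)^{1/p})^q dt/t)^{1/q}$ for $q<\infty$, $\|f\|_{p,\infty}=\sup_{t>0}t d_f(t)^{1/p}$. $\mathcal M^{\rm c}_{\mathfrak X}f(x)=\sup_{s>0}\mu(B(x,s))^{-1}\int_{B(x,s)}|f|d\mu$. $\mathfrak c(p,q,r,\mathfrak X)$ is the smallest $c$ with $\|\mathcal M^{\rm c}_{\mathfrak X}f\|_{p,r}\le c\|f\|_{p,q}$ for all $f\in L^{p,q}(\mathfrak X)$ ($\infty$ if none). A triple $(p,q,r)$ is admissible if either $p=q=1$ and $r\in[1,\infty]$, or $p\in(1,\infty)$ and $q,r\in[1,\infty]$ with $q\le r$. *)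

theory Defs
  imports "HOL-Analysis.Analysis"
begin

definition mms :: "'a metric \<Rightarrow> 'a measure \<Rightarrow> bool" where
  "mms m M \<longleftrightarrow> mspace m \<noteq> {} \<and> space M = mspace m \<and>
     sets M = sigma_sets (mspace m) {U. openin (mtopology_of m) U} \<and>
     (\<forall>x\<in>mspace m. \<forall>s>0. 0 < emeasure M (mball_of m x s) \<and> emeasure M (mball_of m x s) < \<infinity>)"

definition doubling :: "'a metric \<Rightarrow> 'a measure \<Rightarrow> bool" where
  "doubling m M \<longleftrightarrow> (\<exists>(C::real). \<forall>x\<in>mspace m. \<forall>s>0.
      emeasure M (mball_of m x (2 * s)) \<le> ennreal C * emeasure M (mball_of m x s))"

text \<open>Real powers of extended nonnegative reals, for positive exponents (infinity ^ a = infinity).\<close>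
definition ennpowr :: "ennreal \<Rightarrow> real \<Rightarrow> ennreal" where
  "ennpowr x a = (if x = \<infinity> then \<infinity> else ennreal (enn2real x powr a))"

definition outer_meas :: "'a measure \<Rightarrow> 'a set \<Rightarrow> ennreal" where
  "outer_meas M S = (INF A\<in>{A\<in>sets M. S \<subseteq> A}. emeasure M A)"

definition distr_fun :: "'a measure \<Rightarrow> ('a \<Rightarrow> ennreal) \<Rightarrow> real \<Rightarrow> ennreal" where
  "distr_fun M g t = outer_meas M {x\<in>space M. g x > ennreal t}"

definition lorentz_norm_enn :: "'a measure \<Rightarrow> real \<Rightarrow> ereal \<Rightarrow> ('a \<Rightarrow> ennreal) \<Rightarrow> ennreal" where
  "lorentz_norm_enn M p q g =
     (if q = \<infinity> then (SUP t\<in>{0<..}. ennreal t * ennpowr (distr_fun M g t) (1/p))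
      else ennreal (p powr (1 / real_of_ereal q)) *
        ennpowr (\<integral>\<^sup>+ t\<in>{0<..}.
             ennpowr (ennreal t * ennpowr (distr_fun M g t) (1/p)) (real_of_ereal q) / ennreal t \<partial>lborel)
          (1 / real_of_ereal q))"

definition lorentz_norm :: "'a measure \<Rightarrow> real \<Rightarrow> ereal \<Rightarrow> ('a \<Rightarrow> real) \<Rightarrow> ennreal" where
  "lorentz_norm M p q f = lorentz_norm_enn M p q (\<lambda>x. ennreal \<bar>f x\<bar>)"

definition lorentz_space :: "'a measure \<Rightarrow> real \<Rightarrow> ereal \<Rightarrow> ('a \<Rightarrow> real) set" where
  "lorentz_space M p q = {f \<in> borel_measurable M. lorentz_norm M p q f < \<infinity>}"

definition centered_max :: "'a metric \<Rightarrow> 'a measure \<Rightarrow> ('a \<Rightarrow> real) \<Rightarrow> 'a \<Rightarrow> ennreal" where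
  "centered_max m M f x = (SUP s\<in>{0<..}.
      (\<integral>\<^sup>+ y\<in>mball_of m x s. ennreal \<bar>f y\<bar> \<partial>M) / emeasure M (mball_of m x s))"

definition max_const :: "real \<Rightarrow> ereal \<Rightarrow> ereal \<Rightarrow> 'a metric \<Rightarrow> 'a measure \<Rightarrow> ennreal" where
  "max_const p q r m M = Inf {c. \<forall>f\<in>lorentz_space M p q.
      lorentz_norm_enn M p r (centered_max m M f) \<le> c * lorentz_norm M p q f}"

definition admissible :: "real \<Rightarrow> ereal \<Rightarrow> ereal \<Rightarrow> bool" where
  "admissible p q r \<longleftrightarrow> (p = 1 \<and> q = 1 \<and> 1 \<le> r) \<or> (1 < p \<and> 1 \<le> q \<and> 1 \<le> r \<and> q \<le> r)"

end

theory Submission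
  imports Defs
begin

text \<open>
  All spaces are countable graphs of finite total mass with distances \<open>1\<close> (neighbours) and \<open>2\<close>, so
  that the maximal operator only sees singletons, closed neighbourhoods and the whole space. Every
  target \<open>x\<close> is adjacent to its own dummy \<open>z x\<close> and to a source \<open>s x\<close>, while dummies and sources form a
  clique, whose neighbourhoods are as harmless as the whole space. Hence the only interesting part of
  the maximal function is \<open>\<bar>f (s x)\<bar> w (s x) / w (z x)\<close> on targets.

  Around the \<open>k\<close>-th source, \<open>N k\<close> dyadic levels of targets carry distribution function
  \<open>a k / t powr p\<close> (for the indicator of a source of mass one), so that the norm of the operator from
  \<open>L(p,q)\<close> to \<open>L(p,r)\<close> is about \<open>a k powr (1/p) * N k powr (1/r)\<close> on this component. With
  \<open>N k = 2 ^ k\<^sup>2\<close> and \<open>a k powr (1/p) = 2 powr (\<delta> k) / N k powr (1/r0)\<close> these numbers are unbounded in \<open>k\<close>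
  for \<open>r < r0\<close> and tend to zero rapidly for \<open>r > r0\<close>; the sign of \<open>\<delta>\<close> decides the case \<open>r = r0\<close>.
\<close>

subsection \<open>Lorentz norms over finite measures on discrete spaces\<close>

text \<open>The dummy makes the average tunable: the ball of radius \<open>2\<close> about a target
  is \<open>{x, z x, s x}\<close>, and with \<open>w x \<le> w (z x)\<close> and
  \<open>w (z x) = w (s x) * 2 ^ i\<close> the source enters it with a weight between
  \<open>2 ^ (- i) / 3\<close> and \<open>2 ^ (- i)\<close>. Giving each target its own dummy, no
  lighter than itself, keeps the dummy values harmless. Averages over sets containing the clique are
  at most the integral of \<open>\<bar>f\<bar>\<close> divided by the mass of the clique, so
  functions in L(p,q) must be integrable; with finite mass this holds for \<open>p > 1\<close> and
  for \<open>p = q = 1\<close>. The obstacle is adding up infinitely many sources. A weak bound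
  \<open>B\<close> limits the value at a source of mass \<open>w\<close> to
  \<open>B * w powr (- (1 / p))\<close>, and then \<open>w\<close> cancels from every estimate: the
  masses can be made summable without touching \<open>a\<close> and \<open>N\<close>. For finite
  \<open>r\<close> the components are added with weights \<open>2 ^ k\<close>, which works for every
  power \<open>r / p\<close>, below or above one. The quadratic exponents beat these weights away
  from the critical exponent; at a finite critical exponent \<open>\<delta>\<close> has to absorb
  them, hence the condition \<open>\<delta> < - 1\<close> for boundedness.\<close>

lemma ennpowr_ennreal [simp]: "0 \<le> x \<Longrightarrow> ennpowr (ennreal x) a = ennreal (x powr a)"
  by (simp add: ennpowr_def)

lemma ennpowr_mono: "0 \<le> y \<Longrightarrow> 0 \<le> e \<Longrightarrow> ennreal y \<le> x \<Longrightarrow> ennreal (y powr e) \<le> ennpowr x e"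
  by (cases x) (auto simp: ennreal_le_iff powr_mono2 ennpowr_def ennreal_leI)

lemma nn_integral_powr_from_0:
  fixes q b :: real
  assumes "0 < q" "0 \<le> b"
  shows "(\<integral>\<^sup>+ t\<in>{0<..<b}. ennreal (t powr (q - 1)) \<partial>lborel) = ennreal (b powr q / q)"
proof -
  have "(\<integral>\<^sup>+ t. ennreal (t powr (q - 1)) * indicator {0..b} t \<partial>lborel) = ennreal (b powr q / q)"
    using has_integral_powr_from_0[of "q - 1" b] assms
    by (intro nn_integral_has_integral_lebesgue') auto
  moreover have "(\<integral>\<^sup>+ t\<in>{0<..<b}. ennreal (t powr (q - 1)) \<partial>lborel)
      = (\<integral>\<^sup>+ t. ennreal (t powr (q - 1)) * indicator {0..b} t \<partial>lborel)"
    using AE_lborel_singleton[of b] AE_lborel_singleton[of 0]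
    by (intro nn_integral_cong_AE, eventually_elim) (auto simp: indicator_def)
  ultimately show ?thesis by simp
qed

text \<open>When \<open>D\<close> is the distribution function, \<open>p\<close> times this is the
  \<open>q\<close>-th power of the Lorentz quasinorm. A real-valued \<open>D\<close> keeps the
  arithmetic of powers out of \<open>ennreal\<close>.\<close>

definition lorentz_integral :: "real \<Rightarrow> real \<Rightarrow> (real \<Rightarrow> real) \<Rightarrow> ennreal" where
  "lorentz_integral p q D = (\<integral>\<^sup>+ t\<in>{0<..}. ennreal (t powr (q - 1) * D t powr (q / p)) \<partial>lborel)"

text \<open>A Chebyshev inequality: on \<open>(0, t)\<close> the nonincreasing \<open>D\<close> is
  at least \<open>D t\<close>, and the remaining power of \<open>u\<close> integrates to
  \<open>t powr q / q\<close>.\<close>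

lemma lorentz_integral_ge:
  assumes "antimono D" "\<And>t. 0 \<le> D t" "0 < p" "0 < q" "0 < t"
  shows "ennreal (t powr q / q * D t powr (q / p)) \<le> lorentz_integral p q D"
proof -
  have "ennreal (t powr q / q * D t powr (q / p))
      = ennreal (t powr q / q) * ennreal (D t powr (q / p))"
    using assms by (intro ennreal_mult) auto
  also have "\<dots> = (\<integral>\<^sup>+ u\<in>{0<..<t}. ennreal (u powr (q - 1)) \<partial>lborel) * ennreal (D t powr (q / p))"
    using assms by (simp add: nn_integral_powr_from_0)
  also have "\<dots> = (\<integral>\<^sup>+ u. (ennreal (u powr (q - 1)) * indicator {0<..<t} u) * ennreal (D t powr (q / p)) \<partial>lborel)"
    by (rule nn_integral_multc[symmetric]) auto
  also have "\<dots> \<le> lorentz_integral p q D"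
    unfolding lorentz_integral_def
  proof (rule nn_integral_mono)
    fix u :: real
    show "(ennreal (u powr (q - 1)) * indicator {0<..<t} u) * ennreal (D t powr (q / p))
      \<le> ennreal (u powr (q - 1) * D u powr (q / p)) * indicator {0<..} u"
    proof (cases "0 < u \<and> u < t")
      case True
      then have "D t \<le> D u" using assms(1) by (simp add: antimonoD)
      then have "u powr (q - 1) * D t powr (q / p) \<le> u powr (q - 1) * D u powr (q / p)"
        using assms by (intro mult_left_mono powr_mono2) auto
      with True show ?thesis by (simp add: ennreal_mult[symmetric] ennreal_leI)
    qed auto
  qed
  finally show ?thesis .
qed

text \<open>With every subset measurable, the outer measure in \<open>distr_fun\<close> is the
  measure itself, and finiteness makes distribution functions real valued.\<close>

locale finite_pow_measure = finite_measure M for M :: "'a measure" +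
  assumes sets_Pow: "sets M = Pow (space M)"
begin

lemma measurable_all [measurable]: "A \<subseteq> space M \<Longrightarrow> A \<in> sets M"
  by (simp add: sets_Pow)

lemma borel_measurable_all: "(f :: 'a \<Rightarrow> 'b::topological_space) \<in> borel_measurable M"
  by (rule measurableI) (auto simp: sets_Pow)

definition dfun :: "('a \<Rightarrow> ennreal) \<Rightarrow> real \<Rightarrow> real" where
  "dfun g t = measure M {x\<in>space M. g x > ennreal t}"

lemma dfun_nonneg [simp]: "0 \<le> dfun g t"
  by (simp add: dfun_def)

lemma antimono_dfun: "antimono (dfun g)"
proof (rule antimonoI)
  fix s t :: real
  assume "s \<le> t"
  then have "ennreal s \<le> ennreal t" by (rule ennreal_leI)
  then have "ennreal s < g x" if "ennreal t < g x" for x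
    using that by (rule le_less_trans)
  then show "dfun g t \<le> dfun g s"
    unfolding dfun_def by (intro finite_measure_mono) auto
qed

lemma borel_measurable_dfun [measurable]: "dfun g \<in> borel_measurable borel"
  using borel_measurable_mono[of "\<lambda>t. - dfun g t"] antimono_dfun[of g]
  by (auto simp: mono_def antimono_def)

lemma outer_meas_eq:
  assumes "S \<subseteq> space M"
  shows "outer_meas M S = emeasure M S"
  unfolding outer_meas_def
proof (rule antisym)
  have "S \<in> {A \<in> sets M. S \<subseteq> A}"
    using assms sets_Pow by blast
  then show "(INF A\<in>{A \<in> sets M. S \<subseteq> A}. emeasure M A) \<le> emeasure M S"
    by (rule INF_lower)
  show "emeasure M S \<le> (INF A\<in>{A \<in> sets M. S \<subseteq> A}. emeasure M A)"
    by (rule INF_greatest) (blast intro: emeasure_mono)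
qed

lemma distr_fun_eq: "distr_fun M g t = ennreal (dfun g t)"
  unfolding distr_fun_def dfun_def
  by (subst outer_meas_eq) (rule Collect_restrict, rule emeasure_eq_measure)

lemma lorentz_norm_enn_real:
  assumes "0 < p" "0 < q"
  shows "lorentz_norm_enn M p (ereal q) g
    = ennreal (p powr (1 / q)) * ennpowr (lorentz_integral p q (dfun g)) (1 / q)"
proof -
  have "ennpowr (ennreal t * ennpowr (distr_fun M g t) (1/p)) q / ennreal t * indicator {0<..} t
     = ennreal (t powr (q - 1) * dfun g t powr (q / p)) * indicator {0<..} t" for t
  proof (cases "0 < t")
    case True
    have "ennpowr (ennreal t * ennpowr (distr_fun M g t) (1/p)) q / ennreal t
        = ennreal ((t * dfun g t powr (1/p)) powr q / t)"
      using True by (simp add: distr_fun_eq ennreal_mult[symmetric] divide_ennreal)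
    also have "(t * dfun g t powr (1/p)) powr q / t = t powr (q - 1) * dfun g t powr (q / p)"
      using True by (simp add: powr_mult powr_powr powr_diff)
    finally show ?thesis by simp
  qed auto
  then show ?thesis
    by (simp add: lorentz_norm_enn_def lorentz_integral_def)
qed

lemma lorentz_norm_enn_infinity:
  assumes "0 < p"
  shows "lorentz_norm_enn M p \<infinity> g = (SUP t\<in>{0<..}. ennreal (t * dfun g t powr (1 / p)))"
  unfolding lorentz_norm_enn_def
  by (auto intro!: SUP_cong simp: distr_fun_eq ennreal_mult)

lemma lorentz_norm_enn_real_eqD:
  assumes "0 < p" "0 < q" "0 \<le> H" "lorentz_norm_enn M p (ereal q) g = ennreal H"
  shows "lorentz_integral p q (dfun g) = ennreal (H powr q / p)"
proof (cases "lorentz_integral p q (dfun g)")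
  case (real x)
  with assms have "p powr (1 / q) * x powr (1 / q) = H"
    by (simp add: lorentz_norm_enn_real ennreal_mult[symmetric])
  then have "H powr q = p * x"
    using real assms by (auto simp: powr_mult powr_powr)
  then show ?thesis using real assms by simp
next
  case top
  with assms show ?thesis
    by (simp add: lorentz_norm_enn_real ennpowr_def ennreal_mult_top)
qed

lemma lorentz_norm_enn_real_leI:
  assumes "0 < p" "0 < q" "0 \<le> H" "0 \<le> K"
    "lorentz_integral p q (dfun g) \<le> ennreal (K * H powr q)"
  shows "lorentz_norm_enn M p (ereal q) g \<le> ennreal ((p * K) powr (1 / q)) * ennreal H"
proof -
  obtain x where x: "0 \<le> x" "lorentz_integral p q (dfun g) = ennreal x" "x \<le> K * H powr q"
    using assms by (cases "lorentz_integral p q (dfun g)") (auto simp: top_unique)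
  have "x powr (1 / q) \<le> (K * H powr q) powr (1 / q)"
    using x assms by (intro powr_mono2) auto
  also have "\<dots> = K powr (1 / q) * H"
    using assms by (auto simp: powr_mult powr_powr)
  finally have "p powr (1 / q) * x powr (1 / q) \<le> (p * K) powr (1 / q) * H"
    using assms by (simp add: powr_mult mult_left_mono mult.assoc)
  then show ?thesis
    using x assms by (simp add: lorentz_norm_enn_real ennreal_mult[symmetric] ennreal_leI)
qed

text \<open>The embedding of L(p,q) into L(p,infinity), with a constant uniform in \<open>g\<close>
  and \<open>t\<close>. For finite \<open>q\<close> it is the \<open>q\<close>-th root of
  \<open>lorentz_integral_ge\<close>, which yields \<open>(q / p) powr (1 / q)\<close>.\<close>

lemma lorentz_weak_bound:
  assumes "0 < p" "0 < q"
  shows "\<exists>c\<ge>0. \<forall>g H t. lorentz_norm_enn M p q g = ennreal H \<longrightarrow> 0 \<le> H \<longrightarrow> 0 < t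
       \<longrightarrow> t * dfun g t powr (1 / p) \<le> c * H"
proof (cases q)
  case (real q')
  define c where "c = (q' / p) powr (1 / q')"
  show ?thesis
  proof (intro exI[of _ c] conjI allI impI)
    fix g and H t :: real
    assume *: "lorentz_norm_enn M p q g = ennreal H" "0 \<le> H" "0 < t"
    have q': "0 < q'" using real assms by simp
    have "ennreal (t powr q' / q' * dfun g t powr (q' / p)) \<le> ennreal (H powr q' / p)"
      using lorentz_integral_ge[OF antimono_dfun dfun_nonneg assms(1) q' *(3), of g]
        lorentz_norm_enn_real_eqD[OF assms(1) q' *(2)] * real by simp
    then have "t powr q' / q' * dfun g t powr (q' / p) \<le> H powr q' / p"
      using assms by (simp add: ennreal_le_iff)
    then have "t powr q' * dfun g t powr (q' / p) \<le> q' / p * H powr q'"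
      using q' assms by (simp add: field_simps)
    then have "(t powr q' * dfun g t powr (q' / p)) powr (1 / q') \<le> (q' / p * H powr q') powr (1 / q')"
      using q' by (intro powr_mono2) auto
    then show "t * dfun g t powr (1 / p) \<le> c * H"
      using q' * assms by (simp add: powr_mult powr_powr c_def del: times_divide_eq_left)
  qed (simp add: c_def)
next
  case PInf
  show ?thesis
  proof (intro exI[of _ "1::real"] conjI allI impI)
    fix g and H t :: real
    assume *: "lorentz_norm_enn M p q g = ennreal H" "0 \<le> H" "0 < t"
    have "ennreal (t * dfun g t powr (1 / p)) \<le> lorentz_norm_enn M p q g"
      unfolding PInf lorentz_norm_enn_infinity[OF assms(1)] using * by (intro SUP_upper) auto
    then show "t * dfun g t powr (1 / p) \<le> 1 * H"
      using * by (simp add: ennreal_le_iff)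
  qed simp
qed (use assms in simp)

section \<open>Layer cake formula and embeddings of Lorentz spaces\<close>

lemma layer_cake:
  "(\<integral>\<^sup>+ x. ennreal \<bar>f x\<bar> \<partial>M) = (\<integral>\<^sup>+ t\<in>{0<..}. ennreal (dfun (\<lambda>x. ennreal \<bar>f x\<bar>) t) \<partial>lborel)"
proof -
  interpret P: pair_sigma_finite M lborel ..
  have [measurable]: "f \<in> borel_measurable M" by (rule borel_measurable_all)
  have "(\<integral>\<^sup>+ x. ennreal \<bar>f x\<bar> \<partial>M) = (\<integral>\<^sup>+ x. (\<integral>\<^sup>+ t. indicator {p. 0 < snd p \<and> snd p < \<bar>f (fst p)\<bar>} (x, t) \<partial>lborel) \<partial>M)"
  proof (rule nn_integral_cong)
    fix x
    have "(\<integral>\<^sup>+ t. indicator {p. 0 < snd p \<and> snd p < \<bar>f (fst p)\<bar>} (x, t) \<partial>lborel)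
       = (\<integral>\<^sup>+ t. indicator {0<..<\<bar>f x\<bar>} t \<partial>lborel)"
      by (intro nn_integral_cong) (auto simp: indicator_def)
    then show "ennreal \<bar>f x\<bar> = (\<integral>\<^sup>+ t. indicator {p. 0 < snd p \<and> snd p < \<bar>f (fst p)\<bar>} (x, t) \<partial>lborel)"
      by simp
  qed
  also have "\<dots> = (\<integral>\<^sup>+ t. (\<integral>\<^sup>+ x. indicator {p. 0 < snd p \<and> snd p < \<bar>f (fst p)\<bar>} (x, t) \<partial>M) \<partial>lborel)"
  proof (rule P.Fubini'[symmetric])
    have "{p \<in> space (M \<Otimes>\<^sub>M lborel). 0 < snd p \<and> snd p < \<bar>f (fst p)\<bar>} \<in> sets (M \<Otimes>\<^sub>M lborel)"
      by measurable
    then show "(\<lambda>(x, t). indicator {p. 0 < snd p \<and> snd p < \<bar>f (fst p)\<bar>} (x, t) :: ennreal) \<in> borel_measurable (M \<Otimes>\<^sub>M lborel)"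
      by (subst measurable_cong[where g = "indicator {p \<in> space (M \<Otimes>\<^sub>M lborel). 0 < snd p \<and> snd p < \<bar>f (fst p)\<bar>}"])
         (auto simp: indicator_def)
  qed
  also have "\<dots> = (\<integral>\<^sup>+ t\<in>{0<..}. ennreal (dfun (\<lambda>x. ennreal \<bar>f x\<bar>) t) \<partial>lborel)"
  proof (rule nn_integral_cong)
    fix t :: real
    have "(\<integral>\<^sup>+ x. indicator {p. 0 < snd p \<and> snd p < \<bar>f (fst p)\<bar>} (x, t) \<partial>M)
       = (\<integral>\<^sup>+ x. indicator {x\<in>space M. 0 < t \<and> t < \<bar>f x\<bar>} x \<partial>M)"
      by (intro nn_integral_cong) (auto simp: indicator_def)
    also have "\<dots> = emeasure M {x\<in>space M. 0 < t \<and> t < \<bar>f x\<bar>}"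
      by (rule nn_integral_indicator) auto
    also have "\<dots> = ennreal (dfun (\<lambda>x. ennreal \<bar>f x\<bar>) t) * indicator {0<..} t"
      by (cases "0 < t") (auto simp: dfun_def emeasure_eq_measure ennreal_less_iff)
    finally show "(\<integral>\<^sup>+ x. indicator {p. 0 < snd p \<and> snd p < \<bar>f (fst p)\<bar>} (x, t) \<partial>M)
      = ennreal (dfun (\<lambda>x. ennreal \<bar>f x\<bar>) t) * indicator {0<..} t" .
  qed
  finally show ?thesis .
qed

text \<open>Layer cake, with the distribution function bounded by the total mass for
  \<open>t \<le> B\<close> and by \<open>(B / t) powr p\<close> beyond. The tail converges because
  \<open>p > 1\<close> and contributes \<open>B / (p - 1)\<close>.\<close>

lemma weak_imp_integrable:
  assumes "1 < p" "0 \<le> B" "\<And>t. 0 < t \<Longrightarrow> t * dfun (\<lambda>x. ennreal \<bar>f x\<bar>) t powr (1 / p) \<le> B"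
  shows "(\<integral>\<^sup>+ x. ennreal \<bar>f x\<bar> \<partial>M) \<le> ennreal ((measure M (space M) + 1 / (p - 1)) * B)"
proof -
  let ?D = "dfun (\<lambda>x. ennreal \<bar>f x\<bar>)"
  have D: "?D t \<le> (B / t) powr p" if "0 < t" for t
  proof -
    have "?D t powr (1 / p) \<le> B / t"
      using assms(3)[OF that] that by (simp add: field_simps)
    then have "(?D t powr (1 / p)) powr p \<le> (B / t) powr p"
      using assms by (intro powr_mono2) auto
    then show ?thesis using assms by (simp add: powr_powr)
  qed
  show ?thesis
  proof (cases "B = 0")
    case True
    then have "?D t = 0" if "0 < t" for t
      using D[OF that] assms dfun_nonneg[of "\<lambda>x. ennreal \<bar>f x\<bar>" t] by simp
    then have "(\<integral>\<^sup>+ t\<in>{0<..}. ennreal (?D t) \<partial>lborel) = (\<integral>\<^sup>+ t. 0 \<partial>(lborel :: real measure))"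
      by (intro nn_integral_cong) (auto simp: indicator_def)
    then show ?thesis by (simp add: layer_cake)
  next
    case False
    with assms have B: "0 < B" by simp
    have "(\<integral>\<^sup>+ t\<in>{0<..}. ennreal (?D t) \<partial>lborel) \<le>
      (\<integral>\<^sup>+ t. ennreal (measure M (space M)) * indicator {0..B} t
         + ennreal (B powr p) * (ennreal (t powr (- p)) * indicator {B..} t) \<partial>lborel)"
    proof (rule nn_integral_mono)
      fix t
      consider "t \<le> 0" | "0 < t" "t \<le> B" | "B < t" by linarith
      then show "ennreal (?D t) * indicator {0<..} t \<le> ennreal (measure M (space M)) * indicator {0..B} t
         + ennreal (B powr p) * (ennreal (t powr (- p)) * indicator {B..} t)"
      proof cases
        case 2
        have "?D t \<le> measure M (space M)"
          unfolding dfun_def by (intro finite_measure_mono) auto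
        with 2 show ?thesis by (auto intro: add_increasing2 ennreal_leI)
      next
        case 3
        then have "?D t \<le> B powr p * t powr (- p)"
          using D[of t] B by (simp add: powr_divide powr_minus field_simps)
        with 3 B show ?thesis by (simp add: ennreal_mult[symmetric] ennreal_leI)
      qed auto
    qed
    also have "\<dots> = ennreal (measure M (space M)) * ennreal B
        + ennreal (B powr p) * (\<integral>\<^sup>+ t. ennreal (t powr (- p)) * indicator {B..} t \<partial>lborel)"
      using B by (subst nn_integral_add) (auto simp: nn_integral_cmult nn_integral_cmult_indicator)
    also have "(\<integral>\<^sup>+ t. ennreal (t powr (- p)) * indicator {B..} t \<partial>lborel) = ennreal (- (B powr (- p + 1)) / (- p + 1))"
      using has_integral_powr_to_inf[of "- p" B] B assms
      by (intro nn_integral_has_integral_lebesgue') auto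
    also have "- (B powr (- p + 1)) / (- p + 1) = B powr (1 - p) / (p - 1)"
      using assms by (simp add: field_simps)
    also have "ennreal (measure M (space M)) * ennreal B + ennreal (B powr p) * ennreal (B powr (1 - p) / (p - 1))
      = ennreal (measure M (space M) * B + B powr p * (B powr (1 - p) / (p - 1)))"
      using assms by (simp add: ennreal_mult[symmetric] ennreal_plus[symmetric] del: ennreal_plus)
    also have "B powr p * (B powr (1 - p) / (p - 1)) = 1 / (p - 1) * B"
      using B by (simp add: powr_add[symmetric])
    finally show ?thesis by (simp add: layer_cake distrib_right)
  qed
qed

text \<open>For \<open>p = q = 1\<close> the quasinorm is the norm of L1 by the layer cake formula;
  for \<open>p > 1\<close> the weak bound suffices on a finite measure. The integral is what
  controls averages over large balls.\<close>

lemma lorentz_imp_integrable: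
  assumes "p = 1 \<and> q = 1 \<or> 1 < p \<and> 1 \<le> q"
  shows "\<exists>c\<ge>0. \<forall>f H. lorentz_norm M p q f = ennreal H \<longrightarrow> 0 \<le> H
    \<longrightarrow> (\<integral>\<^sup>+ x. ennreal \<bar>f x\<bar> \<partial>M) \<le> ennreal (c * H)"
proof (cases "p = 1 \<and> q = 1")
  case True
  show ?thesis
  proof (intro exI[of _ "1::real"] conjI allI impI)
    fix f and H :: real
    assume *: "lorentz_norm M p q f = ennreal H" "0 \<le> H"
    have "lorentz_integral 1 1 (dfun (\<lambda>x. ennreal \<bar>f x\<bar>)) = ennreal H"
      using lorentz_norm_enn_real_eqD[of 1 1 H "\<lambda>x. ennreal \<bar>f x\<bar>"] * True
      by (simp add: lorentz_norm_def one_ereal_def)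
    moreover have "lorentz_integral 1 1 (dfun (\<lambda>x. ennreal \<bar>f x\<bar>))
       = (\<integral>\<^sup>+ t\<in>{0<..}. ennreal (dfun (\<lambda>x. ennreal \<bar>f x\<bar>) t) \<partial>lborel)"
      unfolding lorentz_integral_def by (intro nn_integral_cong) (auto simp: indicator_def)
    ultimately show "(\<integral>\<^sup>+ x. ennreal \<bar>f x\<bar> \<partial>M) \<le> ennreal (1 * H)"
      by (simp add: layer_cake)
  qed simp
next
  case False
  with assms have p: "1 < p" "0 < p" "0 < q" by (auto intro: less_le_trans[of 0 1])
  from lorentz_weak_bound[OF p(2,3)]
  obtain c where c: "0 \<le> c" "\<forall>g H t. lorentz_norm_enn M p q g = ennreal H \<longrightarrow> 0 \<le> H \<longrightarrow> 0 < t
       \<longrightarrow> t * dfun g t powr (1 / p) \<le> c * H"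
    by (elim exE conjE)
  show ?thesis
  proof (intro exI[of _ "(measure M (space M) + 1 / (p - 1)) * c"] conjI allI impI)
    fix f and H :: real
    assume *: "lorentz_norm M p q f = ennreal H" "0 \<le> H"
    then have "t * dfun (\<lambda>x. ennreal \<bar>f x\<bar>) t powr (1 / p) \<le> c * H" if "0 < t" for t
      using c(2) that by (simp add: lorentz_norm_def)
    from weak_imp_integrable[OF p(1) _ this] c(1) *(2)
    show "(\<integral>\<^sup>+ x. ennreal \<bar>f x\<bar> \<partial>M) \<le> ennreal ((measure M (space M) + 1 / (p - 1)) * c * H)"
      by (simp add: mult.assoc)
  qed (use c(1) p in simp)
qed

text \<open>The integrand for \<open>r\<close> is the integrand for \<open>q\<close> times
  \<open>(t * dfun g t powr (1 / p)) powr (r - q)\<close>, and this extra factor is bounded by the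
  weak estimate.\<close>

lemma lorentz_embedding:
  fixes q r :: real
  assumes "0 < p" "0 < q" "q \<le> r"
  shows "\<exists>c\<ge>0. \<forall>g H. lorentz_norm_enn M p q g = ennreal H \<longrightarrow> 0 \<le> H
       \<longrightarrow> lorentz_integral p r (dfun g) \<le> ennreal (c * H powr r)"
proof -
  have "0 < ereal q" using assms by simp
  from lorentz_weak_bound[OF assms(1) this]
  obtain c where c: "0 \<le> c" "\<forall>g H t. lorentz_norm_enn M p q g = ennreal H \<longrightarrow> 0 \<le> H \<longrightarrow> 0 < t
       \<longrightarrow> t * dfun g t powr (1 / p) \<le> c * H"
    by (elim exE conjE)
  show ?thesis
  proof (intro exI[of _ "(if r = q then 1 else c powr (r - q)) / p"] conjI allI impI)
    fix g and H :: real
    assume *: "lorentz_norm_enn M p q g = ennreal H" "0 \<le> H"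
    \<comment> \<open>Since \<open>0 powr 0 = 0\<close>, the factor with exponent
      \<open>r - q = 0\<close> has to be set to \<open>1\<close> by hand.\<close>
    let ?k = "if r = q then 1 else (c * H) powr (r - q)"
    have "lorentz_integral p r (dfun g) \<le> (\<integral>\<^sup>+ t. ennreal ?k
        * (ennreal (t powr (q - 1) * dfun g t powr (q / p)) * indicator {0<..} t) \<partial>lborel)"
      unfolding lorentz_integral_def
    proof (rule nn_integral_mono)
      fix t
      show "ennreal (t powr (r - 1) * dfun g t powr (r / p)) * indicator {0<..} t
        \<le> ennreal ?k * (ennreal (t powr (q - 1) * dfun g t powr (q / p)) * indicator {0<..} t)"
      proof (cases "0 < t \<and> r \<noteq> q")
        case True
        have "t powr (r - 1) * dfun g t powr (r / p)
          = (t * dfun g t powr (1 / p)) powr (r - q) * (t powr (q - 1) * dfun g t powr (q / p))"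
        proof -
          have "r / p = (r - q) / p + q / p" by (simp add: diff_divide_distrib)
          then have "dfun g t powr (r / p) = dfun g t powr ((r - q) / p) * dfun g t powr (q / p)"
            by (metis powr_add)
          moreover have "t powr (r - 1) = t powr (r - q) * t powr (q - 1)"
            by (simp add: powr_add[symmetric])
          moreover have "(t * dfun g t powr (1 / p)) powr (r - q) = t powr (r - q) * dfun g t powr ((r - q) / p)"
            using True by (simp add: powr_mult powr_powr)
          ultimately show ?thesis by simp
        qed
        moreover have "t * dfun g t powr (1 / p) \<le> c * H"
          using True * c(2) by simp
        then have "(t * dfun g t powr (1 / p)) powr (r - q) * (t powr (q - 1) * dfun g t powr (q / p)) \<le> (c * H) powr (r - q) * (t powr (q - 1) * dfun g t powr (q / p))"
          using True assms by (intro mult_right_mono powr_mono2) auto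
        ultimately show ?thesis using True
          by (simp add: ennreal_mult[symmetric] ennreal_leI)
      qed auto
    qed
    also have "\<dots> = ennreal ?k * lorentz_integral p q (dfun g)"
      unfolding lorentz_integral_def by (rule nn_integral_cmult) measurable
    also have "\<dots> = ennreal ?k * ennreal (H powr q / p)"
      using lorentz_norm_enn_real_eqD[of p q H g] * assms by simp
    also have "\<dots> \<le> ennreal ((if r = q then 1 else c powr (r - q)) / p * H powr r)"
    proof -
      have "H powr r = H powr (r - q) * H powr q"
        by (simp add: powr_add[symmetric])
      then show ?thesis
        using * c assms by (auto simp: ennreal_mult[symmetric] powr_mult mult_ac)
    qed
    finally show "lorentz_integral p r (dfun g) \<le> ennreal ((if r = q then 1 else c powr (r - q)) / p * H powr r)" .
  qed (use assms in auto)
qed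

text \<open>Substitution of \<open>c * t\<close> for \<open>t\<close>. It is applied with
  \<open>c = 4\<close>, since the maximal function is bounded by a sum of four terms and is
  therefore examined at height \<open>4 * t\<close>.\<close>

lemma lorentz_integral_scale:
  assumes "0 < c"
  shows "lorentz_integral p r (dfun g) = ennreal (c powr r)
    * (\<integral>\<^sup>+ t\<in>{0<..}. ennreal (t powr (r - 1) * dfun g (c * t) powr (r / p)) \<partial>lborel)"
proof -
  have "lorentz_integral p r (dfun g) = ennreal \<bar>c\<bar>
    * (\<integral>\<^sup>+ t. ennreal ((0 + c * t) powr (r - 1) * dfun g (0 + c * t) powr (r / p)) * indicator {0<..} (0 + c * t) \<partial>lborel)"
    unfolding lorentz_integral_def using assms by (intro nn_integral_real_affine) auto
  also have "(\<integral>\<^sup>+ t. ennreal ((0 + c * t) powr (r - 1) * dfun g (0 + c * t) powr (r / p)) * indicator {0<..} (0 + c * t) \<partial>lborel)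
    = (\<integral>\<^sup>+ t. ennreal (c powr (r - 1)) * (ennreal (t powr (r - 1) * dfun g (c * t) powr (r / p)) * indicator {0<..} t) \<partial>lborel)"
    using assms by (intro nn_integral_cong)
      (auto simp: indicator_def ennreal_mult[symmetric] powr_mult zero_less_mult_iff mult_ac)
  also have "\<dots> = ennreal (c powr (r - 1)) * (\<integral>\<^sup>+ t\<in>{0<..}. ennreal (t powr (r - 1) * dfun g (c * t) powr (r / p)) \<partial>lborel)"
    by (intro nn_integral_cmult) measurable
  also have "ennreal \<bar>c\<bar> * (ennreal (c powr (r - 1)) * (\<integral>\<^sup>+ t\<in>{0<..}. ennreal (t powr (r - 1) * dfun g (c * t) powr (r / p)) \<partial>lborel))
    = ennreal (\<bar>c\<bar> * c powr (r - 1)) * (\<integral>\<^sup>+ t\<in>{0<..}. ennreal (t powr (r - 1) * dfun g (c * t) powr (r / p)) \<partial>lborel)"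
    by (simp add: ennreal_mult mult.assoc)
  also have "\<bar>c\<bar> * c powr (r - 1) = c powr r"
    using assms by (simp add: powr_diff)
  finally show ?thesis .
qed

end

subsection \<open>Graphs with a clique and targets of degree two\<close>

lemma divide_ennreal_le:
  assumes "a \<le> ennreal J" "ennreal k \<le> b" "0 \<le> J" "0 < k"
  shows "a / b \<le> ennreal (J / k)"
proof (cases b)
  case (real b')
  obtain a' where "a = ennreal a'" "0 \<le> a'"
    using assms(1) by (cases a) (auto simp: top_unique)
  with assms real show ?thesis
    by (auto simp: divide_ennreal intro!: ennreal_leI frac_le)
qed simp

text \<open>\<open>T\<close> holds the targets, \<open>X - T\<close> the clique. Together
  \<open>inj_z\<close> and \<open>w_le\<close> allow the values of \<open>f\<close> at dummies, as
  seen from targets, to be charged to the dummies themselves. \<open>w_le\<close> also keeps a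
  target from dominating the mass of its neighbourhood.\<close>

locale clique_graph =
  fixes X T :: "'a set" and z s :: "'a \<Rightarrow> 'a" and w :: "'a \<Rightarrow> real"
  assumes T_subset: "T \<subseteq> X" and clique_nonempty: "X - T \<noteq> {}"
    and z_in: "x \<in> T \<Longrightarrow> z x \<in> X - T" and s_in: "x \<in> T \<Longrightarrow> s x \<in> X - T"
    and z_neq_s: "x \<in> T \<Longrightarrow> z x \<noteq> s x" and inj_z: "inj_on z T"
    and w_pos: "x \<in> X \<Longrightarrow> 0 < w x" and w_le: "x \<in> T \<Longrightarrow> w x \<le> w (z x)"
    and finite_mass: "emeasure (point_measure X (\<lambda>x. ennreal (w x))) X \<noteq> \<infinity>"
begin

definition M :: "'a measure" where
  "M = point_measure X (\<lambda>x. ennreal (w x))"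

definition adj :: "'a \<Rightarrow> 'a \<Rightarrow> bool" where
  "adj x y \<longleftrightarrow> x \<notin> T \<and> y \<notin> T \<or> x \<in> T \<and> (y = z x \<or> y = s x) \<or> y \<in> T \<and> (x = z y \<or> x = s y)"

definition d :: "'a \<Rightarrow> 'a \<Rightarrow> real" where
  "d x y = (if x = y then 0 else if adj x y then 1 else 2)"

definition m :: "'a metric" where
  "m = metric (X, d)"

lemma space_M [simp]: "space M = X" and sets_M [simp]: "sets M = Pow X"
  by (simp_all add: M_def space_point_measure sets_point_measure)

sublocale finite_pow_measure M
proof (intro finite_pow_measure.intro finite_measureI)
  show "emeasure M (space M) \<noteq> \<infinity>"
    using finite_mass by (simp add: M_def space_point_measure)
  show "finite_pow_measure_axioms M"
    by (rule finite_pow_measure_axioms.intro) simp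
qed

sublocale D: Metric_space X d
proof
  fix x y t
  have "adj x y = adj y x" unfolding adj_def by blast
  then show "d x y = d y x" by (simp add: d_def eq_commute)
  \<comment> \<open>Distinct points have distance \<open>1\<close> or \<open>2\<close>, so two
    nontrivial steps already cover the largest distance.\<close>
  have "x \<noteq> y \<Longrightarrow> y \<noteq> t \<Longrightarrow> 1 \<le> d x y \<and> 1 \<le> d y t" "d x t \<le> 2"
    by (simp_all add: d_def)
  then show "d x t \<le> d x y + d y t"
    by (cases "x = y"; cases "y = t") (auto simp: d_def)
qed (simp_all add: d_def)

lemma mspace_m [simp]: "mspace m = X"
  by (simp add: m_def)

lemma mball_m: "mball_of m x r = (if x \<in> X then {y \<in> X. d x y < r} else {})"
  by (auto simp: m_def)

lemma emeasure_M_finite: "finite A \<Longrightarrow> A \<subseteq> X \<Longrightarrow> emeasure M A = ennreal (\<Sum>x\<in>A. w x)"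
  unfolding M_def
  by (subst emeasure_point_measure_finite2) (auto intro!: sum_ennreal less_imp_le w_pos)

lemma emeasure_M_singleton [simp]: "x \<in> X \<Longrightarrow> emeasure M {x} = ennreal (w x)"
  by (simp add: emeasure_M_finite)

lemma measure_M_ge: "x \<in> A \<Longrightarrow> A \<subseteq> X \<Longrightarrow> w x \<le> measure M A"
proof -
  assume x: "x \<in> A" and A: "A \<subseteq> X"
  then have "emeasure M {x} \<le> emeasure M A"
    by (intro emeasure_mono) auto
  moreover have "emeasure M {x} = ennreal (w x)"
    using x A by (intro emeasure_M_singleton) auto
  ultimately have "ennreal (w x) \<le> ennreal (measure M A)"
    by (simp only: emeasure_eq_measure[of A])
  then show ?thesis by (simp add: ennreal_le_iff)
qed

lemma integral_M_finite:
  assumes "finite A" "A \<subseteq> X"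
  shows "(\<integral>\<^sup>+ y\<in>A. ennreal \<bar>f y\<bar> \<partial>M) = ennreal (\<Sum>x\<in>A. \<bar>f x\<bar> * w x)"
proof -
  have "(\<integral>\<^sup>+ y\<in>A. ennreal \<bar>f y\<bar> \<partial>M) = (\<Sum>x\<in>A. ennreal \<bar>f x\<bar> * emeasure M {x})"
    using assms by (intro nn_integral_indicator_finite) auto
  also have "\<dots> = (\<Sum>x\<in>A. ennreal (\<bar>f x\<bar> * w x))"
    using assms w_pos by (intro sum.cong) (auto simp: ennreal_mult less_imp_le subset_eq)
  also have "\<dots> = ennreal (\<Sum>x\<in>A. \<bar>f x\<bar> * w x)"
    using assms w_pos by (intro sum_ennreal) (auto simp: less_imp_le subset_eq)
  finally show ?thesis .
qed

text \<open>Balls of radius \<open>1\<close> are singletons, so the topology is discrete and the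
  Borel sets are all subsets of \<open>X\<close>.\<close>

lemma mms_graph: "mms m M"
proof -
  have "openin (mtopology_of m) U \<longleftrightarrow> U \<subseteq> X" for U
  proof -
    have "\<exists>r>0. D.mball x r \<subseteq> U" if "x \<in> U" for x
      using that by (intro exI[of _ "1::real"]) (auto simp: d_def split: if_splits)
    then show ?thesis by (auto simp: m_def D.openin_mtopology)
  qed
  then have "{U. openin (mtopology_of m) U} = Pow X" by auto
  moreover have "sigma_sets X (Pow X) = Pow X"
    using sets.sigma_sets_eq[of M] by simp
  moreover have "0 < emeasure M (mball_of m x r) \<and> emeasure M (mball_of m x r) < \<infinity>"
    if "x \<in> X" "0 < r" for x r
  proof -
    have "w x \<le> measure M (mball_of m x r)"
      using that by (intro measure_M_ge) (auto simp: mball_m)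
    then show ?thesis using w_pos[OF that(1)]
      by (auto simp: emeasure_eq_measure)
  qed
  ultimately show ?thesis
    using clique_nonempty by (auto simp: mms_def)
qed

section \<open>Balls of the graph and failure of doubling\<close>

lemma ball_small: "x \<in> X \<Longrightarrow> 0 < r \<Longrightarrow> r \<le> 1 \<Longrightarrow> mball_of m x r = {x}"
  by (auto simp: mball_m d_def split: if_splits)

lemma ball_target: "x \<in> T \<Longrightarrow> 1 < r \<Longrightarrow> r \<le> 2 \<Longrightarrow> mball_of m x r = {x, z x, s x}"
  using T_subset z_in[of x] s_in[of x] by (auto simp: mball_m d_def adj_def dest: z_in s_in split: if_splits)

text \<open>An inclusion is enough: a source also has targets as neighbours, but any average over a
  superset of the clique has denominator at least \<open>measure M (X - T)\<close>.\<close>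

lemma ball_clique: "x \<in> X - T \<Longrightarrow> 1 < r \<Longrightarrow> X - T \<subseteq> mball_of m x r"
  by (auto simp: mball_m d_def adj_def)

lemma ball_large: "x \<in> X \<Longrightarrow> 2 < r \<Longrightarrow> mball_of m x r = X"
  by (auto simp: mball_m d_def)

lemma triple_neq: "x \<in> T \<Longrightarrow> x \<noteq> z x \<and> x \<noteq> s x \<and> z x \<noteq> s x"
  using z_in[of x] s_in[of x] z_neq_s[of x] by auto

text \<open>Doubling the radius from \<open>3 / 2\<close> to \<open>3\<close> around a target
  enlarges its ball from the triple to the whole space, whose mass is fixed while the triple can be
  arbitrarily light.\<close>

lemma not_doubling_graph:
  assumes "\<And>e::real. 0 < e \<Longrightarrow> \<exists>x\<in>T. w x + w (z x) + w (s x) < e"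
  shows "\<not> doubling m M"
proof
  assume "doubling m M"
  then obtain C where C: "\<And>x r. x \<in> X \<Longrightarrow> 0 < r \<Longrightarrow>
      emeasure M (mball_of m x (2 * r)) \<le> ennreal C * emeasure M (mball_of m x r)"
    by (auto simp: doubling_def)
  \<comment> \<open>The doubling constant is an arbitrary real; a positive one is needed to divide
    by it.\<close>
  let ?C = "max C 1"
  obtain k where k: "k \<in> X - T" using clique_nonempty by auto
  then have pos: "0 < measure M X"
    using w_pos[of k] measure_M_ge[of k X] by auto
  then obtain x where x: "x \<in> T" "w x + w (z x) + w (s x) < measure M X / ?C"
    using assms[of "measure M X / ?C"] by auto
  have xX: "x \<in> X" "z x \<in> X" "s x \<in> X" using x T_subset z_in s_in by auto
  have wx: "0 < w x + w (z x) + w (s x)"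
    using xX w_pos by (intro add_pos_pos)
  have "emeasure M (mball_of m x (2 * (3/2))) \<le> ennreal C * emeasure M (mball_of m x (3/2))"
    using xX by (intro C) auto
  then have "ennreal (measure M X) \<le> ennreal C * ennreal (w x + w (z x) + w (s x))"
    using triple_neq[OF x(1)] xX by (simp add: ball_large ball_target x emeasure_M_finite add.assoc) (simp add: emeasure_eq_measure)
  also have "\<dots> \<le> ennreal ?C * ennreal (w x + w (z x) + w (s x))"
    by (intro mult_right_mono ennreal_leI) auto
  also have "\<dots> = ennreal (?C * (w x + w (z x) + w (s x)))"
    using wx by (intro ennreal_mult[symmetric]) auto
  finally have "measure M X \<le> ?C * (w x + w (z x) + w (s x))"
    using wx by (subst (asm) ennreal_le_iff) auto
  then show False using x(2) by (simp add: field_simps)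
qed

section \<open>Pointwise bounds for the maximal function\<close>

lemma centered_max_le:
  assumes "(\<integral>\<^sup>+ y. ennreal \<bar>f y\<bar> \<partial>M) \<le> ennreal J" "0 \<le> J" "x \<in> X"
  shows "centered_max m M f x \<le> ennreal (\<bar>f x\<bar> + J / measure M (X - T)
      + (if x \<in> T then \<bar>f (z x)\<bar> + \<bar>f (s x)\<bar> * (w (s x) / w (z x)) else 0))"
    (is "_ \<le> ennreal ?R")
proof -
  let ?k = "measure M (X - T)"
  obtain k where k: "k \<in> X - T" using clique_nonempty by auto
  then have kpos: "0 < ?k" using w_pos[of k] measure_M_ge[of k "X - T"] by auto
  have nn: "0 \<le> (if x \<in> T then \<bar>f (z x)\<bar> + \<bar>f (s x)\<bar> * (w (s x) / w (z x)) else 0)"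
  proof (cases "x \<in> T")
    case True
    then have "0 < w (s x) / w (z x)" using w_pos z_in s_in by (intro divide_pos_pos) auto
    then have "0 \<le> \<bar>f (s x)\<bar> * (w (s x) / w (z x))" by (intro mult_nonneg_nonneg) auto
    with True show ?thesis by simp
  qed simp
  have J: "J / ?k \<le> ?R" and fx: "\<bar>f x\<bar> \<le> ?R" using nn kpos assms(2) by auto
  have big: "(\<integral>\<^sup>+ y\<in>B. ennreal \<bar>f y\<bar> \<partial>M) / emeasure M B \<le> ennreal ?R" if "X - T \<subseteq> B" "B \<subseteq> X" for B
  proof -
    have "(\<integral>\<^sup>+ y\<in>B. ennreal \<bar>f y\<bar> \<partial>M) \<le> (\<integral>\<^sup>+ y. ennreal \<bar>f y\<bar> \<partial>M)"
      by (intro nn_integral_mono) (auto simp: indicator_def)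
    also note assms(1)
    finally have "(\<integral>\<^sup>+ y\<in>B. ennreal \<bar>f y\<bar> \<partial>M) / emeasure M B \<le> ennreal (J / ?k)"
      using that assms kpos
      by (intro divide_ennreal_le) (auto simp: emeasure_eq_measure intro!: ennreal_leI finite_measure_mono)
    with J show ?thesis using ennreal_leI order_trans by blast
  qed
  have "(\<integral>\<^sup>+ y\<in>mball_of m x r. ennreal \<bar>f y\<bar> \<partial>M) / emeasure M (mball_of m x r) \<le> ennreal ?R"
    if r: "0 < r" for r
  proof -
    \<comment> \<open>The balls are singletons, triples around targets, or supersets of the clique.
      In a triple the points \<open>x\<close> and \<open>z x\<close> have relative mass at most
      \<open>1\<close>, while dropping all but \<open>w (z x)\<close> from the denominator gives
      \<open>s x\<close> the weight \<open>w (s x) / w (z x)\<close>.\<close>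
    consider "r \<le> 1" | "1 < r" "r \<le> 2" "x \<in> T" | "1 < r" "x \<notin> T" | "2 < r" by linarith
    then show ?thesis
    proof cases
      case 1
      have "(\<integral>\<^sup>+ y\<in>{x}. ennreal \<bar>f y\<bar> \<partial>M) / emeasure M {x} \<le> ennreal (\<bar>f x\<bar> * w x / w x)"
        using assms(3) w_pos by (intro divide_ennreal_le) (auto simp: integral_M_finite less_imp_le simp del: nn_integral_indicator_singleton)
      also have "\<dots> \<le> ennreal ?R" using fx w_pos[OF assms(3)] by (auto intro!: ennreal_leI)
      finally show ?thesis using 1 r assms(3) by (simp add: ball_small)
    next
      case 2
      let ?B = "{x, z x, s x}"
      have in_X: "z x \<in> X" "s x \<in> X" using 2 z_in s_in by auto
      have w: "0 < w x" "0 < w (z x)" "0 < w (s x)" using in_X assms(3) w_pos by auto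
      have "(\<integral>\<^sup>+ y\<in>?B. ennreal \<bar>f y\<bar> \<partial>M) / emeasure M ?B
         \<le> ennreal ((\<bar>f x\<bar> * w x + \<bar>f (z x)\<bar> * w (z x) + \<bar>f (s x)\<bar> * w (s x)) / (w x + w (z x) + w (s x)))"
        using assms(3) in_X w triple_neq[OF 2(3)]
        by (intro divide_ennreal_le) (auto simp: integral_M_finite emeasure_M_finite add.assoc)
      also have "(\<bar>f x\<bar> * w x + \<bar>f (z x)\<bar> * w (z x) + \<bar>f (s x)\<bar> * w (s x)) / (w x + w (z x) + w (s x))
         = \<bar>f x\<bar> * (w x / (w x + w (z x) + w (s x))) + \<bar>f (z x)\<bar> * (w (z x) / (w x + w (z x) + w (s x)))
          + \<bar>f (s x)\<bar> * (w (s x) / (w x + w (z x) + w (s x)))"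
        by (simp add: add_divide_distrib)
      also have "\<dots> \<le> \<bar>f x\<bar> * 1 + \<bar>f (z x)\<bar> * 1 + \<bar>f (s x)\<bar> * (w (s x) / w (z x))"
        using w by (intro add_mono mult_left_mono divide_left_mono) auto
      also have "\<dots> \<le> ?R" using 2 kpos assms(2) by simp
      finally show ?thesis using 2 by (simp add: ball_target ennreal_leI)
    next
      case 3
      with assms(3) show ?thesis by (intro big ball_clique) (auto simp: mball_m)
    next
      case 4
      with assms(3) show ?thesis by (intro big) (auto simp: ball_large)
    qed
  qed
  then show ?thesis unfolding centered_max_def by (intro SUP_least) auto
qed

lemma centered_max_ge:
  assumes "x \<in> T"
  shows "ennreal (w (s x) / (w x + w (z x) + w (s x))) \<le> centered_max m M (indicator {s x}) x"
proof -
  have in_X: "x \<in> X" "z x \<in> X" "s x \<in> X" using assms z_in s_in T_subset by auto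
  have w: "0 < w x" "0 < w (z x)" "0 < w (s x)" using in_X w_pos by auto
  have "(\<integral>\<^sup>+ y\<in>mball_of m x 2. ennreal \<bar>indicator {s x} y\<bar> \<partial>M) / emeasure M (mball_of m x 2)
      \<le> centered_max m M (indicator {s x}) x"
    unfolding centered_max_def by (rule SUP_upper) simp
  moreover have "(\<integral>\<^sup>+ y\<in>mball_of m x 2. ennreal \<bar>indicator {s x} y\<bar> \<partial>M) / emeasure M (mball_of m x 2)
     = ennreal (w (s x) / (w x + w (z x) + w (s x)))"
  proof -
    have "(\<integral>\<^sup>+ y\<in>{x, z x, s x}. ennreal \<bar>indicator {s x} y\<bar> \<partial>M) = ennreal (w (s x))"
    proof -
      have "(\<Sum>y\<in>{x, z x, s x}. g y) = g x + (g (z x) + g (s x))" for g :: "'a \<Rightarrow> real"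
        using triple_neq[OF assms] by simp
      moreover have "indicator {s x} x = (0 :: real)" "indicator {s x} (z x) = (0 :: real)"
        using triple_neq[OF assms] by simp_all
      ultimately have "(\<Sum>y\<in>{x, z x, s x}. \<bar>indicator {s x} y\<bar> * w y) = w (s x)"
        by (simp only:) simp
      then show ?thesis using in_X by (subst integral_M_finite) auto
    qed
    moreover have "emeasure M {x, z x, s x} = ennreal (w x + w (z x) + w (s x))"
      using in_X triple_neq[OF assms] by (subst emeasure_M_finite) (auto simp: add.assoc)
    ultimately show ?thesis
      using w by (simp only: ball_target assms divide_ennreal less_imp_le add_pos_pos)
  qed
  ultimately show ?thesis by simp
qed

text \<open>Passing from targets to their dummies is injective and does not decrease weights. As
  \<open>A\<close> may be infinite, its measure is written as an integral against counting measure
  and transported by the bijection \<open>z\<close>.\<close>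

lemma measure_z_image:
  assumes "A \<subseteq> T"
  shows "measure M A \<le> measure M (z ` A)"
proof -
  have zA: "z ` A \<subseteq> X" using assms z_in by auto
  have em: "emeasure M B = (\<integral>\<^sup>+ x. ennreal (w x) \<partial>count_space B)" if "B \<subseteq> X" for B
    using that unfolding M_def point_measure_def
    by (subst emeasure_density)
       (auto simp: nn_integral_count_space_indicator[of B] Int_absorb1 intro!: nn_integral_count_space_eq simp: indicator_def)
  have "emeasure M A = (\<integral>\<^sup>+ x. ennreal (w x) \<partial>count_space A)"
    using assms T_subset by (intro em) auto
  also have "\<dots> \<le> (\<integral>\<^sup>+ x. ennreal (w (z x)) \<partial>count_space A)"
    using assms w_le by (intro nn_integral_mono ennreal_leI) auto
  also have "\<dots> = (\<integral>\<^sup>+ x. ennreal (w x) \<partial>count_space (z ` A))"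
    by (rule nn_integral_bij_count_space) (use inj_z assms in \<open>auto simp: bij_betw_def intro: inj_on_subset\<close>)
  also have "\<dots> = emeasure M (z ` A)"
    using em[OF zA] by simp
  finally show ?thesis by (simp add: emeasure_eq_measure)
qed

end

subsection \<open>Levels of targets\<close>

text \<open>The full geometric sum up to the largest exponent is at most twice its last term once
  the base is at least \<open>2\<close>. The exponents may have gaps, so the bound applies to any
  finite selection of levels.\<close>

lemma sum_power_le_Max:
  fixes b :: real
  assumes "finite A" "A \<noteq> {}" "2 \<le> b"
  shows "(\<Sum>i\<in>A. b ^ i) \<le> 2 * b ^ Max A"
proof -
  have "(\<Sum>i\<le>n. b ^ i) \<le> 2 * b ^ n" for n
  proof (induction n)
    case (Suc n)
    have "2 * b ^ n \<le> b * b ^ n" using assms by (intro mult_right_mono) auto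
    then show ?case using Suc by simp
  qed simp
  moreover have "(\<Sum>i\<in>A. b ^ i) \<le> (\<Sum>i\<le>Max A. b ^ i)"
    using assms by (intro sum_mono2) auto
  ultimately show ?thesis by (meson order_trans)
qed

text \<open>If the right-hand side is a finite \<open>q\<close>, each single term gives
  \<open>y k \<le> q powr (1 / s) * (1 / 2) ^ Suc k\<close>, and these halves sum to
  \<open>q powr (1 / s)\<close>. This replaces subadditivity, which fails for \<open>s > 1\<close>;
  the price is the weight \<open>2 ^ Suc k\<close>.\<close>

lemma powr_suminf_le:
  fixes Y s :: real and y :: "nat \<Rightarrow> real"
  assumes "0 < s" "0 \<le> Y" "\<And>k. 0 \<le> y k" "ennreal Y \<le> (\<Sum>k. ennreal (y k))"
  shows "ennreal (Y powr s) \<le> (\<Sum>k. ennreal ((2 ^ Suc k * y k) powr s))"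
proof (cases "(\<Sum>k. ennreal ((2 ^ Suc k * y k) powr s))")
  case (real q)
  have y: "y k \<le> q powr (1 / s) * (1 / 2) ^ Suc k" for k
  proof -
    have "(\<Sum>i\<in>{k}. ennreal ((2 ^ Suc i * y i) powr s)) \<le> (\<Sum>k. ennreal ((2 ^ Suc k * y k) powr s))"
      by (intro sum_le_suminf) auto
    then have "(2 ^ Suc k * y k) powr s \<le> q"
      using real by (simp add: ennreal_le_iff)
    then have "((2 ^ Suc k * y k) powr s) powr (1 / s) \<le> q powr (1 / s)"
      using assms by (intro powr_mono2) auto
    then have "2 ^ Suc k * y k \<le> q powr (1 / s)"
      using assms by (simp add: powr_powr)
    then show ?thesis by (simp add: field_simps power_one_over)
  qed
  have "(\<Sum>k. ennreal (y k)) \<le> (\<Sum>k. ennreal (q powr (1 / s) * (1 / 2) ^ Suc k))"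
    using y by (intro suminf_le ennreal_leI) auto
  also have "(\<lambda>k. q powr (1 / s) * (1 / 2) ^ Suc k) sums (q powr (1 / s) * 1)"
    by (intro sums_mult power_half_series)
  then have "(\<Sum>k. ennreal (q powr (1 / s) * (1 / 2) ^ Suc k)) = ennreal (q powr (1 / s))"
    by (intro suminf_ennreal_eq) auto
  finally have "Y \<le> q powr (1 / s)"
    using assms(4) by (meson ennreal_le_iff order_trans powr_ge_zero)
  then have "Y powr s \<le> (q powr (1 / s)) powr s"
    using assms by (intro powr_mono2) auto
  then show ?thesis using real assms by (simp add: powr_powr ennreal_leI)
qed simp

lemma powr_add3_le:
  fixes x y u s :: real
  assumes "0 \<le> x" "0 \<le> y" "0 \<le> u" "0 \<le> s"
  shows "(x + y + u) powr s \<le> 3 powr s * (x powr s + y powr s + u powr s)"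
proof -
  have "(x + y + u) powr s \<le> (3 * max x (max y u)) powr s"
    using assms by (intro powr_mono2) auto
  also have "\<dots> = 3 powr s * max x (max y u) powr s"
    using assms by (simp add: powr_mult)
  also have "\<dots> \<le> 3 powr s * (x powr s + y powr s + u powr s)"
    by (intro mult_left_mono) (auto simp: max_def)
  finally show ?thesis .
qed

lemma max_const_less_top:
  assumes "\<exists>C\<ge>0. \<forall>f\<in>lorentz_space M p q.
    lorentz_norm_enn M p r (centered_max m M f) \<le> ennreal C * lorentz_norm M p q f"
  shows "max_const p q r m M < \<infinity>"
proof -
  obtain C where "\<forall>f\<in>lorentz_space M p q.
    lorentz_norm_enn M p r (centered_max m M f) \<le> ennreal C * lorentz_norm M p q f"
    using assms by blast
  then have "max_const p q r m M \<le> ennreal C"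
    unfolding max_const_def by (intro Inf_lower) auto
  also have "\<dots> < \<infinity>" by simp
  finally show ?thesis .
qed

text \<open>The convention 1 / infinity = 0 puts the weak endpoint under the same formula
  \<open>a k powr (1 / p) * N k powr inv_exponent r\<close> as the finite exponents.\<close>

definition inv_exponent :: "ereal \<Rightarrow> real" where
  "inv_exponent r = (if r = \<infinity> then 0 else 1 / real_of_ereal r)"

text \<open>The targets come in levels \<open>L k i\<close>: the source \<open>\<sigma> k\<close> of mass \<open>w (\<sigma> k)\<close> is seen from \<open>L k i\<close>
  with average about \<open>2 ^ (- i)\<close>, on a set of measure \<open>w (\<sigma> k) * a k * 2 powr (i p)\<close>. All \<open>N k\<close> levels
  contribute equally to the Lorentz integral.\<close>

locale level_graph = clique_graph X T z s w for X T z s w +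
  fixes p :: real and \<sigma> :: "nat \<Rightarrow> 'a" and a :: "nat \<Rightarrow> real" and N :: "nat \<Rightarrow> nat"
    and L :: "nat \<Rightarrow> nat \<Rightarrow> 'a set"
  assumes p_ge1: "1 \<le> p" and a_pos: "0 < a k" and N_pos: "0 < N k"
    and sigma_in: "\<sigma> k \<in> X"
    and T_eq: "T = (\<Union>k. \<Union>i\<in>{..<N k}. L k i)"
    and s_L: "i < N k \<Longrightarrow> x \<in> L k i \<Longrightarrow> s x = \<sigma> k"
    and w_L: "i < N k \<Longrightarrow> x \<in> L k i \<Longrightarrow> w (z x) = w (\<sigma> k) * 2 ^ i"
    and measure_L: "i < N k \<Longrightarrow> measure M (L k i) = w (\<sigma> k) * a k * (2 powr p) ^ i"
begin

section \<open>Distribution of the source term\<close>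

lemma L_subset: "i < N k \<Longrightarrow> L k i \<subseteq> T"
  unfolding T_eq by blast

lemma w_sigma_pos [simp]: "0 < w (\<sigma> k)"
  by (rule w_pos[OF sigma_in])

lemma w_sigma_neq_0 [simp]: "w (\<sigma> k) \<noteq> 0"
  using w_sigma_pos[of k] by linarith

text \<open>The total mass of those levels around \<open>\<sigma> k\<close> on which
  \<open>2 ^ (- i)\<close> times the largest value permitted at the source by a weak bound
  \<open>B\<close> exceeds \<open>t\<close>.\<close>

definition source_dist :: "real \<Rightarrow> nat \<Rightarrow> real \<Rightarrow> real" where
  "source_dist B k t = (\<Sum>i | i < N k \<and> t * 2 ^ i < B * w (\<sigma> k) powr (- (1 / p)).
     w (\<sigma> k) * a k * (2 powr p) ^ i)"

lemma source_dist_nonneg: "0 \<le> source_dist B k t"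
  unfolding source_dist_def using a_pos w_sigma_pos
  by (intro sum_nonneg mult_nonneg_nonneg) (auto intro: less_imp_le)

text \<open>Distribution function of the one term in \<open>centered_max_le\<close> that can destroy
  boundedness.\<close>

definition source_part :: "('a \<Rightarrow> real) \<Rightarrow> real \<Rightarrow> real" where
  "source_part f t = measure M {x \<in> T. t < \<bar>f (s x)\<bar> * (w (s x) / w (z x))}"

lemma source_part_le:
  assumes "0 < t" "\<And>k. \<bar>f (\<sigma> k)\<bar> \<le> B * w (\<sigma> k) powr (- (1 / p))"
  shows "ennreal (source_part f t) \<le> (\<Sum>k. ennreal (source_dist B k t))"
proof -
  let ?A = "\<lambda>k. {i. i < N k \<and> t * 2 ^ i < B * w (\<sigma> k) powr (- (1 / p))}"
  let ?U = "\<lambda>k. \<Union>i\<in>?A k. L k i"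
  have UX: "?U k \<subseteq> X" and LX: "i \<in> ?A k \<Longrightarrow> L k i \<subseteq> X" for i k
    using L_subset T_subset by blast+
  have sub: "{x \<in> T. t < \<bar>f (s x)\<bar> * (w (s x) / w (z x))} \<subseteq> (\<Union>k. ?U k)"
  proof
    fix x assume x: "x \<in> {x \<in> T. t < \<bar>f (s x)\<bar> * (w (s x) / w (z x))}"
    then obtain k i where ki: "i < N k" "x \<in> L k i" unfolding T_eq by auto
    have "w (s x) / w (z x) = 1 / 2 ^ i"
      using w_sigma_pos[of k] by (simp only: s_L[OF ki] w_L[OF ki]) (simp add: field_simps)
    moreover have "t < \<bar>f (s x)\<bar> * (w (s x) / w (z x))" using x by blast
    ultimately have "t < \<bar>f (\<sigma> k)\<bar> / 2 ^ i"
      by (simp only: s_L[OF ki]) simp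
    then have "t * 2 ^ i < \<bar>f (\<sigma> k)\<bar>" by (simp add: field_simps)
    with assms(2)[of k] have "i \<in> ?A k" using ki by auto
    with ki show "x \<in> (\<Union>k. ?U k)" by blast
  qed
  have "ennreal (source_part f t) \<le> emeasure M (\<Union>k. ?U k)"
    unfolding source_part_def emeasure_eq_measure[symmetric]
    using UX by (intro emeasure_mono[OF sub]) auto
  also have "\<dots> \<le> (\<Sum>k. emeasure M (?U k))"
    using UX by (intro emeasure_subadditive_countably) auto
  also have "\<dots> \<le> (\<Sum>k. ennreal (source_dist B k t))"
  proof (intro suminf_le)
    fix k
    have "emeasure M (?U k) \<le> (\<Sum>i\<in>?A k. emeasure M (L k i))"
      using LX by (intro emeasure_subadditive_finite) auto
    also have "\<dots> = (\<Sum>i\<in>?A k. ennreal (w (\<sigma> k) * a k * (2 powr p) ^ i))"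
      by (intro sum.cong refl) (simp only: emeasure_eq_measure mem_Collect_eq measure_L)
    also have "\<dots> = ennreal (source_dist B k t)"
      unfolding source_dist_def using a_pos w_sigma_pos
      by (intro sum_ennreal mult_nonneg_nonneg) (auto intro: less_imp_le)
    finally show "emeasure M (?U k) \<le> ennreal (source_dist B k t)" .
  qed auto
  finally show ?thesis .
qed

text \<open>Level masses grow by the factor \<open>2 powr p\<close>, which is at least
  \<open>2\<close>, so the highest level in the sum carries at least half of it. Having a single
  level makes both the weak bound and arbitrary powers easy.\<close>

lemma source_dist_le_Max:
  assumes "0 < t"
  obtains (zero) "source_dist B k t = 0"
    | (attained) n where "n < N k" "t * 2 ^ n < B * w (\<sigma> k) powr (- (1 / p))"
      "source_dist B k t \<le> 2 * (w (\<sigma> k) * a k * (2 powr p) ^ n)"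
proof -
  let ?A = "{i. i < N k \<and> t * 2 ^ i < B * w (\<sigma> k) powr (- (1 / p))}"
  show ?thesis
  proof (cases "?A = {}")
    case True
    then have "source_dist B k t = 0" unfolding source_dist_def by (simp only: sum.empty)
    then show ?thesis by (rule zero)
  next
    case False
    have fin: "finite ?A" by (rule finite_subset[of _ "{..<N k}"]) auto
    have "2 powr 1 \<le> 2 powr p" using p_ge1 by (intro powr_mono) auto
    then have "(\<Sum>i\<in>?A. (2 powr p) ^ i) \<le> 2 * (2 powr p) ^ Max ?A"
      by (intro sum_power_le_Max fin False) simp
    then have "w (\<sigma> k) * a k * (\<Sum>i\<in>?A. (2 powr p) ^ i) \<le> w (\<sigma> k) * a k * (2 * (2 powr p) ^ Max ?A)"
      using a_pos[of k] w_sigma_pos[of k] by (intro mult_left_mono mult_nonneg_nonneg) (auto intro: less_imp_le)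
    moreover have "Max ?A \<in> ?A" by (rule Max_in[OF fin False])
    ultimately show ?thesis
      by (intro attained[of "Max ?A"]) (auto simp: source_dist_def sum_distrib_left)
  qed
qed

lemma powr_sigma: "(B * w (\<sigma> k) powr (- (1 / p))) powr r = B powr r * w (\<sigma> k) powr (- (r / p))" if "0 \<le> B"
  using that by (simp only: powr_mult powr_powr powr_ge_zero) simp

text \<open>For the top level \<open>n\<close>, raising
  \<open>t * 2 ^ n < B * w (\<sigma> k) powr (- (1 / p))\<close> to the power \<open>p\<close>
  bounds \<open>w (\<sigma> k) * (2 powr p) ^ n\<close> by \<open>(B / t) powr p\<close>. The mass
  of the source and the number of levels both disappear.\<close>

lemma source_dist_weak:
  assumes "0 < t" "0 \<le> B"
  shows "source_dist B k t \<le> 2 * a k * (B / t) powr p"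
proof (rule source_dist_le_Max[OF assms(1), of B k])
  fix n assume n: "t * 2 ^ n < B * w (\<sigma> k) powr (- (1 / p))"
    "source_dist B k t \<le> 2 * (w (\<sigma> k) * a k * (2 powr p) ^ n)"
  have "(t * 2 ^ n) powr p \<le> (B * w (\<sigma> k) powr (- (1 / p))) powr p"
    using n assms p_ge1 by (intro powr_mono2) auto
  also have "\<dots> = B powr p / w (\<sigma> k)"
    using p_ge1 assms by (simp only: powr_sigma) (simp add: powr_minus_divide less_imp_le)
  also have "(t * 2 ^ n) powr p = t powr p * (2 powr p) ^ n"
    using assms by (simp add: powr_mult powr_powr powr_realpow[symmetric] mult.commute)
  finally have "w (\<sigma> k) * (2 powr p) ^ n \<le> B powr p / t powr p"
    using assms w_sigma_pos[of k] by (simp add: field_simps)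
  then have "a k * (w (\<sigma> k) * (2 powr p) ^ n) \<le> a k * (B / t) powr p"
    using a_pos[of k] assms by (intro mult_left_mono) (auto simp: powr_divide)
  with n(2) show ?thesis by (simp add: mult_ac)
qed (use a_pos[of k] in \<open>auto simp: less_imp_le\<close>)

text \<open>The power is applied to the top level only, which is then one summand of the right-hand
  side. The indicators turn the bound into something that can be integrated in \<open>t\<close>
  level by level.\<close>

lemma source_dist_powr:
  assumes "0 < t" "0 < r"
  shows "source_dist B k t powr (r / p) \<le> (\<Sum>i<N k. (2 * (w (\<sigma> k) * a k)) powr (r / p) * (2 ^ i) powr r
      * indicator {0<..<B * w (\<sigma> k) powr (- (1 / p)) / 2 ^ i} t)" (is "_ \<le> ?R")
proof (rule source_dist_le_Max[OF assms(1), of B k])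
  assume "source_dist B k t = 0"
  then show ?thesis by (simp add: sum_nonneg)
next
  fix n assume n: "n < N k" "t * 2 ^ n < B * w (\<sigma> k) powr (- (1 / p))"
    "source_dist B k t \<le> 2 * (w (\<sigma> k) * a k * (2 powr p) ^ n)"
  have "source_dist B k t powr (r / p) \<le> (2 * (w (\<sigma> k) * a k * (2 powr p) ^ n)) powr (r / p)"
    using n assms p_ge1 source_dist_nonneg by (intro powr_mono2) auto
  also have "\<dots> = (2 * (w (\<sigma> k) * a k)) powr (r / p) * ((2 powr p) ^ n) powr (r / p)"
    using a_pos[of k] w_sigma_pos[of k] by (simp add: powr_mult[symmetric] mult_ac less_imp_le)
  also have "((2 powr p) ^ n) powr (r / p) = (2 ^ n) powr r"
    using p_ge1 by (simp add: powr_realpow[symmetric] powr_powr mult_ac)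
  also have "(2 * (w (\<sigma> k) * a k)) powr (r / p) * (2 ^ n) powr r
    = (\<Sum>i\<in>{n}. (2 * (w (\<sigma> k) * a k)) powr (r / p) * (2 ^ i) powr r
      * indicator {0<..<B * w (\<sigma> k) powr (- (1 / p)) / 2 ^ i} t)"
    using n assms by (simp add: indicator_def field_simps)
  also have "\<dots> \<le> ?R"
    using n by (intro sum_mono2) auto
  finally show ?thesis .
qed

text \<open>Level \<open>i\<close> contributes until the height \<open>\<tau> k i\<close>,
  proportional to \<open>2 ^ (- i)\<close>, and its mass to the power \<open>r / p\<close> is
  proportional to \<open>2 powr (i * r)\<close>. These effects cancel, so all \<open>N k\<close>
  levels contribute equally.\<close>

lemma source_part_integral:
  assumes B: "0 \<le> B" "\<And>k. \<bar>f (\<sigma> k)\<bar> \<le> B * w (\<sigma> k) powr (- (1 / p))" and r: "0 < r"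
    and S: "summable (\<lambda>k. (2 ^ k * a k) powr (r / p) * N k)"
  shows "(\<integral>\<^sup>+ t\<in>{0<..}. ennreal (t powr (r - 1) * source_part f t powr (r / p)) \<partial>lborel)
    \<le> ennreal (4 powr (r / p) / r * (\<Sum>k. (2 ^ k * a k) powr (r / p) * N k) * B powr r)"
proof -
  let ?e = "r / p"
  define \<tau> where "\<tau> k i = B * w (\<sigma> k) powr (- (1 / p)) / 2 ^ i" for k i
  \<comment> \<open>The factor \<open>2 ^ Suc k\<close> comes from \<open>powr_suminf_le\<close> and
    the factor \<open>2\<close> from the geometric sum over levels; together they make up the
    \<open>4 * 2 ^ k\<close> in the result.\<close>
  define c where "c k i = (2 ^ Suc k) powr ?e * ((2 * (w (\<sigma> k) * a k)) powr ?e * (2 ^ i) powr r)" for k :: nat and i :: nat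
  have e: "0 < ?e" using r p_ge1 by simp
  have c0: "0 \<le> c k i" for k i by (simp add: c_def)
  have tau0: "0 \<le> \<tau> k i" for k i using B by (simp add: \<tau>_def)
  have pointwise: "ennreal (t powr (r - 1) * source_part f t powr ?e) * indicator {0<..} t
    \<le> (\<Sum>k. \<Sum>i<N k. ennreal (c k i) * (ennreal (t powr (r - 1)) * indicator {0<..<\<tau> k i} t))" for t
  proof (cases "0 < t")
    case True
    have "ennreal (source_part f t powr ?e) \<le> (\<Sum>k. ennreal ((2 ^ Suc k * source_dist B k t) powr ?e))"
      using e source_dist_nonneg source_part_le[OF True B(2)]
      by (intro powr_suminf_le) (auto simp: source_part_def)
    also have "\<dots> \<le> (\<Sum>k. ennreal (\<Sum>i<N k. c k i * indicator {0<..<\<tau> k i} t))"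
    proof (intro suminf_le ennreal_leI)
      fix k
      have "(2 ^ Suc k * source_dist B k t) powr ?e = (2 ^ Suc k) powr ?e * source_dist B k t powr ?e"
        using source_dist_nonneg by (simp add: powr_mult)
      also have "\<dots> \<le> (2 ^ Suc k) powr ?e * (\<Sum>i<N k. (2 * (w (\<sigma> k) * a k)) powr ?e * (2 ^ i) powr r
          * indicator {0<..<B * w (\<sigma> k) powr (- (1 / p)) / 2 ^ i} t)"
        by (intro mult_left_mono source_dist_powr True r) auto
      also have "\<dots> = (\<Sum>i<N k. c k i * indicator {0<..<\<tau> k i} t)"
        by (simp only: sum_distrib_left c_def \<tau>_def mult.assoc)
      finally show "(2 ^ Suc k * source_dist B k t) powr ?e \<le> (\<Sum>i<N k. c k i * indicator {0<..<\<tau> k i} t)" .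
    qed auto
    finally have "ennreal (t powr (r - 1)) * ennreal (source_part f t powr ?e)
      \<le> ennreal (t powr (r - 1)) * (\<Sum>k. ennreal (\<Sum>i<N k. c k i * indicator {0<..<\<tau> k i} t))"
      by (rule mult_left_mono) simp
    also have "\<dots> = (\<Sum>k. ennreal (t powr (r - 1)) * ennreal (\<Sum>i<N k. c k i * indicator {0<..<\<tau> k i} t))"
      by simp
    also have "\<dots> = (\<Sum>k. \<Sum>i<N k. ennreal (c k i) * (ennreal (t powr (r - 1)) * indicator {0<..<\<tau> k i} t))"
    proof (intro arg_cong[where f = suminf] ext)
      fix k
      have "ennreal (\<Sum>i<N k. c k i * indicator {0<..<\<tau> k i} t) = (\<Sum>i<N k. ennreal (c k i * indicator {0<..<\<tau> k i} t))"
        using c0 by (intro sum_ennreal[symmetric]) auto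
      also have "\<dots> = (\<Sum>i<N k. ennreal (c k i) * indicator {0<..<\<tau> k i} t)"
        by (intro sum.cong) (auto simp: indicator_def)
      finally show "ennreal (t powr (r - 1)) * ennreal (\<Sum>i<N k. c k i * indicator {0<..<\<tau> k i} t)
        = (\<Sum>i<N k. ennreal (c k i) * (ennreal (t powr (r - 1)) * indicator {0<..<\<tau> k i} t))"
        by (simp only: sum_distrib_left mult_ac)
    qed
    finally show ?thesis using True by (simp add: ennreal_mult)
  qed simp
  have "(\<integral>\<^sup>+ t\<in>{0<..}. ennreal (t powr (r - 1) * source_part f t powr ?e) \<partial>lborel)
    \<le> (\<integral>\<^sup>+ t. (\<Sum>k. \<Sum>i<N k. ennreal (c k i) * (ennreal (t powr (r - 1)) * indicator {0<..<\<tau> k i} t)) \<partial>lborel)"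
    by (intro nn_integral_mono pointwise)
  also have "\<dots> = (\<Sum>k. \<integral>\<^sup>+ t. (\<Sum>i<N k. ennreal (c k i) * (ennreal (t powr (r - 1)) * indicator {0<..<\<tau> k i} t)) \<partial>lborel)"
    by (intro nn_integral_suminf) measurable
  also have "\<dots> = (\<Sum>k. ennreal (4 powr ?e / r * B powr r * ((2 ^ k * a k) powr ?e * N k)))"
  proof (intro arg_cong[where f = suminf] ext)
    fix k
    have "(\<integral>\<^sup>+ t. (\<Sum>i<N k. ennreal (c k i) * (ennreal (t powr (r - 1)) * indicator {0<..<\<tau> k i} t)) \<partial>lborel)
      = (\<Sum>i<N k. \<integral>\<^sup>+ t. ennreal (c k i) * (ennreal (t powr (r - 1)) * indicator {0<..<\<tau> k i} t) \<partial>lborel)"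
      by (intro nn_integral_sum) measurable
    also have "\<dots> = (\<Sum>i<N k. ennreal (c k i) * (\<integral>\<^sup>+ t\<in>{0<..<\<tau> k i}. ennreal (t powr (r - 1)) \<partial>lborel))"
      by (intro sum.cong refl nn_integral_cmult) measurable
    also have "\<dots> = (\<Sum>i<N k. ennreal (c k i) * ennreal (\<tau> k i powr r / r))"
      by (simp only: nn_integral_powr_from_0[OF r tau0])
    also have "\<dots> = (\<Sum>i<N k. ennreal (c k i * (\<tau> k i powr r / r)))"
      using c0 r by (intro sum.cong refl ennreal_mult[symmetric]) auto
    also have "\<dots> = ennreal (\<Sum>i<N k. c k i * (\<tau> k i powr r / r))"
      using c0 r by (intro sum_ennreal) auto
    \<comment> \<open>Both \<open>2 ^ i\<close> and \<open>w (\<sigma> k)\<close> cancel here, so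
      the summand no longer depends on \<open>i\<close> or on the mass of the source.\<close>
    also have "(\<Sum>i<N k. c k i * (\<tau> k i powr r / r)) = (\<Sum>i<N k. 4 powr ?e / r * B powr r * (2 ^ k * a k) powr ?e)"
    proof (intro sum.cong refl)
      fix i
      have "\<tau> k i powr r = B powr r * w (\<sigma> k) powr (- ?e) / (2 ^ i) powr r"
        using B by (simp only: \<tau>_def powr_divide powr_sigma[OF B(1)])
      moreover have "c k i = (2 ^ Suc k * (2 * (w (\<sigma> k) * a k))) powr ?e * (2 ^ i) powr r"
        using a_pos[of k] w_sigma_pos[of k] by (simp add: c_def powr_mult[symmetric] less_imp_le)
      moreover have "2 ^ Suc k * (2 * (w (\<sigma> k) * a k)) = (4 * (2 ^ k * a k)) * w (\<sigma> k)" by simp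
      moreover have "\<dots> powr ?e = 4 powr ?e * (2 ^ k * a k) powr ?e * w (\<sigma> k) powr ?e"
        using a_pos[of k] by (simp add: powr_mult less_imp_le)
      ultimately show "c k i * (\<tau> k i powr r / r) = 4 powr ?e / r * B powr r * (2 ^ k * a k) powr ?e"
        using w_sigma_pos[of k] by (simp add: powr_minus field_simps)
    qed
    finally show "(\<integral>\<^sup>+ t. (\<Sum>i<N k. ennreal (c k i) * (ennreal (t powr (r - 1)) * indicator {0<..<\<tau> k i} t)) \<partial>lborel)
      = ennreal (4 powr ?e / r * B powr r * ((2 ^ k * a k) powr ?e * N k))"
      by (simp add: mult_ac)
  qed
  also have "\<dots> = ennreal (\<Sum>k. 4 powr ?e / r * B powr r * ((2 ^ k * a k) powr ?e * N k))"
    using S r by (intro suminf_ennreal2 summable_mult) auto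
  also have "(\<Sum>k. 4 powr ?e / r * B powr r * ((2 ^ k * a k) powr ?e * N k))
    = 4 powr ?e / r * B powr r * (\<Sum>k. (2 ^ k * a k) powr ?e * N k)"
    by (rule suminf_mult[OF S])
  finally show ?thesis by (simp add: mult_ac)
qed

section \<open>Boundedness of the maximal operator\<close>

lemma antimono_source_part: "antimono (source_part f)"
  unfolding source_part_def using T_subset
  by (intro antimonoI finite_measure_mono) auto

lemma borel_measurable_source_part [measurable]: "source_part f \<in> borel_measurable borel"
  using borel_measurable_mono[of "\<lambda>t. - source_part f t"] antimono_source_part[of f]
  by (auto simp: mono_def antimono_def)

text \<open>Where a sum of four terms exceeds \<open>4 * t\<close>, one of them exceeds
  \<open>t\<close>. The values at \<open>x\<close> and, by \<open>measure_z_image\<close>, those at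
  \<open>z x\<close> cost one distribution function of \<open>f\<close> each; the constant term
  exceeds \<open>t\<close> everywhere or nowhere.\<close>

lemma dfun_centered_max_le:
  assumes J: "(\<integral>\<^sup>+ x. ennreal \<bar>f x\<bar> \<partial>M) \<le> ennreal J" "0 \<le> J" and t: "0 < t"
  shows "dfun (centered_max m M f) (4 * t) \<le> 2 * dfun (\<lambda>x. ennreal \<bar>f x\<bar>) t
    + (if t < J / measure M (X - T) then measure M X else 0) + source_part f t"
proof -
  let ?k = "measure M (X - T)"
  let ?A1 = "{x \<in> X. ennreal t < ennreal \<bar>f x\<bar>}" and ?A2 = "if t < J / ?k then X else {}"
    and ?A3 = "{x \<in> T. t < \<bar>f (z x)\<bar>}" and ?A4 = "{x \<in> T. t < \<bar>f (s x)\<bar> * (w (s x) / w (z x))}"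
  have sub: "{x \<in> space M. ennreal (4 * t) < centered_max m M f x} \<subseteq> (?A1 \<union> ?A3) \<union> ?A2 \<union> ?A4"
  proof (rule subsetI, rule ccontr)
    fix x assume x: "x \<in> {x \<in> space M. ennreal (4 * t) < centered_max m M f x}"
      and nx: "x \<notin> (?A1 \<union> ?A3) \<union> ?A2 \<union> ?A4"
    have xX: "x \<in> X" using x by simp
    have "ennreal (4 * t) < ennreal (\<bar>f x\<bar> + J / ?k
      + (if x \<in> T then \<bar>f (z x)\<bar> + \<bar>f (s x)\<bar> * (w (s x) / w (z x)) else 0))"
      using x centered_max_le[OF J xX] by (auto intro: less_le_trans)
    then have "4 * t < \<bar>f x\<bar> + J / ?k
      + (if x \<in> T then \<bar>f (z x)\<bar> + \<bar>f (s x)\<bar> * (w (s x) / w (z x)) else 0)"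
      using t by (simp only: ennreal_less_iff)
    moreover have "\<bar>f x\<bar> \<le> t" using nx xX t by (simp add: ennreal_less_iff)
    moreover have "J / ?k \<le> t" using nx xX by (auto split: if_splits)
    moreover have "\<bar>f (z x)\<bar> \<le> t" "\<bar>f (s x)\<bar> * (w (s x) / w (z x)) \<le> t" if "x \<in> T"
      using nx that by (auto simp only: Un_iff mem_Collect_eq not_less)
    ultimately show False using t by (cases "x \<in> T") auto
  qed
  have X: "?A1 \<subseteq> X" "?A2 \<subseteq> X" "?A3 \<subseteq> X" "?A4 \<subseteq> X" using T_subset by auto
  have "z ` ?A3 \<subseteq> ?A1" using z_in t by (auto simp: ennreal_less_iff)
  then have "measure M ?A3 \<le> measure M ?A1"
    using measure_z_image[of ?A3] finite_measure_mono[of "z ` ?A3" ?A1] by auto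
  moreover have "measure M {x \<in> space M. ennreal (4 * t) < centered_max m M f x} \<le> measure M ((?A1 \<union> ?A3) \<union> ?A2 \<union> ?A4)"
    using X by (intro finite_measure_mono[OF sub]) auto
  moreover have "measure M ((?A1 \<union> ?A3) \<union> ?A2 \<union> ?A4) \<le> measure M ?A1 + measure M ?A3 + measure M ?A2 + measure M ?A4"
  proof -
    have un: "measure M (A \<union> B) \<le> measure M A + measure M B" if "A \<subseteq> X" "B \<subseteq> X" for A B
      using that by (intro measure_Un_le) auto
    show ?thesis
      using un[of "(?A1 \<union> ?A3) \<union> ?A2" ?A4] un[of "?A1 \<union> ?A3" ?A2] un[of ?A1 ?A3] X by simp
  qed
  moreover have "measure M ?A2 = (if t < J / ?k then measure M X else 0)" by simp
  moreover have "measure M ?A1 = dfun (\<lambda>x. ennreal \<bar>f x\<bar>) t" by (simp add: dfun_def)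
  ultimately show ?thesis unfolding dfun_def[of "centered_max m M f"] source_part_def by linarith
qed

text \<open>For \<open>t\<close> below \<open>\<bar>f (\<sigma> k)\<bar>\<close> the level set
  contains \<open>\<sigma> k\<close>, so its measure is at least \<open>w (\<sigma> k)\<close>.
  Choosing an intermediate \<open>t\<close> replaces the passage to the limit.\<close>

lemma source_value_le:
  assumes "\<And>t. 0 < t \<Longrightarrow> t * dfun (\<lambda>x. ennreal \<bar>f x\<bar>) t powr (1 / p) \<le> B"
  shows "\<bar>f (\<sigma> k)\<bar> \<le> B * w (\<sigma> k) powr (- (1 / p))"
proof (rule ccontr)
  let ?w = "w (\<sigma> k) powr (1 / p)"
  assume "\<not> ?thesis"
  then have less: "B / ?w < \<bar>f (\<sigma> k)\<bar>"
    by (simp add: powr_minus field_simps)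
  have w: "0 < ?w" by simp
  have B: "0 \<le> B" using assms[of 1] by (auto intro: order_trans[OF powr_ge_zero])
  obtain t where t: "B / ?w < t" "t < \<bar>f (\<sigma> k)\<bar>" using dense[OF less] by blast
  have t0: "0 < t" using t(1) B w by (meson divide_nonneg_pos le_less_trans)
  have "w (\<sigma> k) \<le> dfun (\<lambda>x. ennreal \<bar>f x\<bar>) t"
    unfolding dfun_def using sigma_in t t0
    by (intro measure_M_ge) (auto simp: ennreal_less_iff)
  then have "?w \<le> dfun (\<lambda>x. ennreal \<bar>f x\<bar>) t powr (1 / p)"
    using p_ge1 by (intro powr_mono2) (auto intro: less_imp_le)
  then have "t * ?w \<le> B" using assms[OF t0] t0 by (meson mult_left_mono less_imp_le order_trans)
  then show False using t w by (simp add: field_simps)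
qed

lemma le_powr_if_root_le:
  assumes "0 \<le> x" "0 < t" "0 \<le> B" "t * x powr (1 / p) \<le> B"
  shows "x \<le> (B / t) powr p"
proof -
  have "x powr (1 / p) \<le> B / t" using assms by (simp add: field_simps)
  then have "(x powr (1 / p)) powr p \<le> (B / t) powr p"
    using p_ge1 by (intro powr_mono2) auto
  then show ?thesis using assms p_ge1 by (simp add: powr_powr)
qed

lemma centered_max_bounded_real:
  assumes pq: "p = 1 \<and> q = 1 \<or> 1 < p \<and> 1 \<le> q" and qr: "q \<le> ereal r"
    and S: "summable (\<lambda>k. (2 ^ k * a k) powr (r / p) * N k)"
  shows "\<exists>C\<ge>0. \<forall>f\<in>lorentz_space M p q.
    lorentz_norm_enn M p (ereal r) (centered_max m M f) \<le> ennreal C * lorentz_norm M p q f"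
proof -
  have q1: "1 \<le> q" using pq by auto
  then obtain q' where q': "q = ereal q'" using qr by (cases q) auto
  have q'1: "1 \<le> q'" using q1 by (simp add: q' one_ereal_def)
  have r: "q' \<le> r" "0 < r" using qr q'1 by (simp_all add: q')
  have p0: "0 < p" using p_ge1 by simp
  have q0: "0 < q" using q'1 by (simp add: q')
  let ?D = "\<lambda>f. dfun (\<lambda>x. ennreal \<bar>f x\<bar>)"
  let ?\<kappa> = "measure M (X - T)"
  let ?e = "r / p"
  have e0: "0 < ?e" using r p0 by simp
  from lorentz_imp_integrable[OF pq] obtain c1 where c1: "0 \<le> c1"
    "\<forall>f H. lorentz_norm M p q f = ennreal H \<longrightarrow> 0 \<le> H \<longrightarrow> (\<integral>\<^sup>+ x. ennreal \<bar>f x\<bar> \<partial>M) \<le> ennreal (c1 * H)"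
    by (elim exE conjE)
  from lorentz_weak_bound[OF p0 q0] obtain c2 where c2: "0 \<le> c2"
    "\<forall>g H t. lorentz_norm_enn M p q g = ennreal H \<longrightarrow> 0 \<le> H \<longrightarrow> 0 < t \<longrightarrow> t * dfun g t powr (1 / p) \<le> c2 * H"
    by (elim exE conjE)
  have q'0: "0 < q'" using q'1 by simp
  from lorentz_embedding[OF p0 q'0 r(1)] obtain c3 where c3: "0 \<le> c3"
    "\<forall>g H. lorentz_norm_enn M p (ereal q') g = ennreal H \<longrightarrow> 0 \<le> H \<longrightarrow> lorentz_integral p r (dfun g) \<le> ennreal (c3 * H powr r)"
    by (elim exE conjE)
  \<comment> \<open>\<open>K1\<close> accounts for \<open>f\<close> at a point and at its dummy,
    \<open>K2\<close> for averages over large sets, \<open>K3\<close> for the sources. In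
    \<open>K\<close>, the factor \<open>4 powr r\<close> comes from rescaling heights and
    \<open>3 powr (r / p)\<close> from splitting the power of a three-term sum.\<close>
  define K1 where "K1 = 2 powr ?e * c3"
  define K2 where "K2 = measure M X powr ?e * ((c1 / ?\<kappa>) powr r / r)"
  define K3 where "K3 = 4 powr ?e / r * (\<Sum>k. (2 ^ k * a k) powr ?e * N k) * c2 powr r"
  define K where "K = 4 powr r * (3 powr ?e * (K1 + K2 + K3))"
  have S0: "0 \<le> (\<Sum>k. (2 ^ k * a k) powr ?e * N k)" using S by (intro suminf_nonneg) auto
  have nn: "0 \<le> K1" "0 \<le> K2" "0 \<le> K3" "0 \<le> K"
    using c1 c2 c3 r S0 by (auto simp: K1_def K2_def K3_def K_def intro!: mult_nonneg_nonneg add_nonneg_nonneg)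
  show ?thesis
  proof (intro exI[of _ "(p * K) powr (1 / r)"] conjI ballI)
    fix f assume f: "f \<in> lorentz_space M p q"
    then obtain H where H: "lorentz_norm M p q f = ennreal H" "0 \<le> H"
      by (cases "lorentz_norm M p q f") (auto simp: lorentz_space_def)
    have H': "lorentz_norm_enn M p q (\<lambda>x. ennreal \<bar>f x\<bar>) = ennreal H"
      using H by (simp add: lorentz_norm_def)
    have J: "(\<integral>\<^sup>+ x. ennreal \<bar>f x\<bar> \<partial>M) \<le> ennreal (c1 * H)"
      using c1(2) H by blast
    have weak: "t * ?D f t powr (1 / p) \<le> c2 * H" if "0 < t" for t
      using c2(2) H' H(2) that by blast
    have B0: "0 \<le> c2 * H" and J0: "0 \<le> c1 * H" using c1 c2 H by auto
    define b where "b = c1 * H / ?\<kappa>"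
    have b0: "0 \<le> b" using J0 by (simp add: b_def)
    let ?E = "\<lambda>t. if t < b then measure M X else 0"
    let ?I1 = "\<lambda>t. ennreal (t powr (r - 1) * ?D f t powr ?e) * indicator {0<..} t"
    let ?I2 = "\<lambda>t. ennreal (t powr (r - 1)) * indicator {0<..<b} t"
    let ?I3 = "\<lambda>t. ennreal (t powr (r - 1) * source_part f t powr ?e) * indicator {0<..} t"
    have pointwise: "ennreal (t powr (r - 1) * dfun (centered_max m M f) (4 * t) powr ?e) * indicator {0<..} t
      \<le> ennreal (3 powr ?e) * (ennreal (2 powr ?e) * ?I1 t + ennreal (measure M X powr ?e) * ?I2 t + ?I3 t)" for t
    proof (cases "0 < t")
      case True
      have "dfun (centered_max m M f) (4 * t) powr ?e \<le> (2 * ?D f t + ?E t + source_part f t) powr ?e"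
        using dfun_centered_max_le[OF J J0 True] e0 by (intro powr_mono2) (auto simp: b_def)
      also have "\<dots> \<le> 3 powr ?e * ((2 * ?D f t) powr ?e + ?E t powr ?e + source_part f t powr ?e)"
        using e0 by (intro powr_add3_le) (auto simp: source_part_def)
      also have "\<dots> = 3 powr ?e * (2 powr ?e * ?D f t powr ?e + ?E t powr ?e + source_part f t powr ?e)"
        by (simp add: powr_mult)
      finally have "t powr (r - 1) * dfun (centered_max m M f) (4 * t) powr ?e
        \<le> t powr (r - 1) * (3 powr ?e * (2 powr ?e * ?D f t powr ?e + ?E t powr ?e + source_part f t powr ?e))"
        by (rule mult_left_mono) simp
      also have "\<dots> = 3 powr ?e * (2 powr ?e * (t powr (r - 1) * ?D f t powr ?e)
          + measure M X powr ?e * (if t < b then t powr (r - 1) else 0) + t powr (r - 1) * source_part f t powr ?e)"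
        by (simp add: algebra_simps)
      finally have "ennreal (t powr (r - 1) * dfun (centered_max m M f) (4 * t) powr ?e)
        \<le> ennreal (3 powr ?e * (2 powr ?e * (t powr (r - 1) * ?D f t powr ?e)
          + measure M X powr ?e * (if t < b then t powr (r - 1) else 0) + t powr (r - 1) * source_part f t powr ?e))"
        by (rule ennreal_leI)
      also have "\<dots> = ennreal (3 powr ?e) * (ennreal (2 powr ?e) * ennreal (t powr (r - 1) * ?D f t powr ?e)
          + ennreal (measure M X powr ?e) * ennreal (if t < b then t powr (r - 1) else 0)
          + ennreal (t powr (r - 1) * source_part f t powr ?e))"
        by (simp add: ennreal_mult)
      finally show ?thesis using True by (cases "t < b") simp_all
    qed simp
    have [measurable]: "(\<lambda>t. ?D f t) \<in> borel_measurable borel" by measurable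
    have I1: "(\<integral>\<^sup>+ t. ?I1 t \<partial>lborel) \<le> ennreal (c3 * H powr r)"
      using c3(2) H' H(2) unfolding q' lorentz_integral_def by blast
    have I2: "(\<integral>\<^sup>+ t. ?I2 t \<partial>lborel) = ennreal (b powr r / r)"
      by (rule nn_integral_powr_from_0[OF r(2) b0])
    have I3: "(\<integral>\<^sup>+ t. ?I3 t \<partial>lborel) \<le> ennreal (K3 * H powr r)"
      using source_part_integral[OF B0 source_value_le[OF weak] r(2) S] H(2) c2(1)
      by (simp add: K3_def powr_mult mult_ac)
    have scaled: "lorentz_integral p r (dfun (centered_max m M f))
      \<le> ennreal (4 powr r) * (\<integral>\<^sup>+ t. ennreal (3 powr ?e) * (ennreal (2 powr ?e) * ?I1 t + ennreal (measure M X powr ?e) * ?I2 t + ?I3 t) \<partial>lborel)"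
      by (subst lorentz_integral_scale[of 4]) (auto intro!: mult_left_mono nn_integral_mono pointwise)
    have "(\<integral>\<^sup>+ t. ennreal (3 powr ?e) * (ennreal (2 powr ?e) * ?I1 t + ennreal (measure M X powr ?e) * ?I2 t + ?I3 t) \<partial>lborel)
      = ennreal (3 powr ?e) * (ennreal (2 powr ?e) * (\<integral>\<^sup>+ t. ?I1 t \<partial>lborel)
          + ennreal (measure M X powr ?e) * (\<integral>\<^sup>+ t. ?I2 t \<partial>lborel) + (\<integral>\<^sup>+ t. ?I3 t \<partial>lborel))"
      by (simp add: nn_integral_cmult nn_integral_add)
    also have "\<dots> \<le> ennreal (3 powr ?e) * (ennreal (2 powr ?e) * ennreal (c3 * H powr r)
          + ennreal (measure M X powr ?e) * ennreal (b powr r / r) + ennreal (K3 * H powr r))"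
      unfolding I2 by (intro mult_left_mono add_mono I1 I3 order_refl) auto
    also have "\<dots> = ennreal (3 powr ?e * (K1 * H powr r + K2 * H powr r + K3 * H powr r))"
    proof -
      have "measure M X powr ?e * (b powr r / r) = K2 * H powr r"
        using c1(1) H(2) by (simp add: K2_def b_def powr_mult powr_divide)
      then have "ennreal (measure M X powr ?e) * ennreal (b powr r / r) = ennreal (K2 * H powr r)"
        using r by (simp add: ennreal_mult[symmetric])
      moreover have "ennreal (2 powr ?e) * ennreal (c3 * H powr r) = ennreal (K1 * H powr r)"
        using c3(1) by (simp add: ennreal_mult[symmetric] K1_def mult.assoc)
      ultimately show ?thesis using nn by (simp add: ennreal_mult)
    qed
    finally have "lorentz_integral p r (dfun (centered_max m M f))
      \<le> ennreal (4 powr r) * ennreal (3 powr ?e * (K1 * H powr r + K2 * H powr r + K3 * H powr r))"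
      by (intro order_trans[OF scaled] mult_left_mono) auto
    also have "\<dots> = ennreal (K * H powr r)"
      using nn by (simp add: K_def ennreal_mult[symmetric] algebra_simps del: ennreal_plus)
    finally have "lorentz_integral p r (dfun (centered_max m M f)) \<le> ennreal (K * H powr r)" .
    then show "lorentz_norm_enn M p (ereal r) (centered_max m M f) \<le> ennreal ((p * K) powr (1 / r)) * lorentz_norm M p q f"
      unfolding H(1) by (intro lorentz_norm_enn_real_leI p0 r H nn)
  qed simp
qed

text \<open>For the weak target norm, distribution functions are compared at a fixed height, where
  they add without any power. Hence neither the weights \<open>2 ^ k\<close> nor the numbers
  \<open>N k\<close> enter, and summability of \<open>a\<close> suffices.\<close>

lemma centered_max_bounded_infinity:
  assumes pq: "p = 1 \<and> q = 1 \<or> 1 < p \<and> 1 \<le> q" and S: "summable a"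
  shows "\<exists>C\<ge>0. \<forall>f\<in>lorentz_space M p q.
    lorentz_norm_enn M p \<infinity> (centered_max m M f) \<le> ennreal C * lorentz_norm M p q f"
proof -
  have q0: "0 < q" using pq by (auto intro: less_le_trans[of 0 1 q])
  have p0: "0 < p" using p_ge1 by simp
  let ?D = "\<lambda>f. dfun (\<lambda>x. ennreal \<bar>f x\<bar>)"
  let ?\<kappa> = "measure M (X - T)"
  from lorentz_imp_integrable[OF pq] obtain c1 where c1: "0 \<le> c1"
    "\<forall>f H. lorentz_norm M p q f = ennreal H \<longrightarrow> 0 \<le> H \<longrightarrow> (\<integral>\<^sup>+ x. ennreal \<bar>f x\<bar> \<partial>M) \<le> ennreal (c1 * H)"
    by (elim exE conjE)
  from lorentz_weak_bound[OF p0 q0] obtain c2 where c2: "0 \<le> c2"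
    "\<forall>g H t. lorentz_norm_enn M p q g = ennreal H \<longrightarrow> 0 \<le> H \<longrightarrow> 0 < t \<longrightarrow> t * dfun g t powr (1 / p) \<le> c2 * H"
    by (elim exE conjE)
  have S0: "0 \<le> suminf a" using S a_pos by (intro suminf_nonneg) (auto intro: less_imp_le)
  \<comment> \<open>Each of the three contributions to the distribution function is at most its
    summand here times \<open>(H / t) powr p\<close>.\<close>
  define K where "K = 2 * c2 powr p + measure M X * (c1 / ?\<kappa>) powr p + 2 * suminf a * c2 powr p"
  have K0: "0 \<le> K" using S0 by (simp add: K_def)
  show ?thesis
  proof (intro exI[of _ "4 * K powr (1 / p)"] conjI ballI)
    fix f assume f: "f \<in> lorentz_space M p q"
    then obtain H where H: "lorentz_norm M p q f = ennreal H" "0 \<le> H"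
      by (cases "lorentz_norm M p q f") (auto simp: lorentz_space_def)
    have H': "lorentz_norm_enn M p q (\<lambda>x. ennreal \<bar>f x\<bar>) = ennreal H"
      using H by (simp add: lorentz_norm_def)
    have J: "(\<integral>\<^sup>+ x. ennreal \<bar>f x\<bar> \<partial>M) \<le> ennreal (c1 * H)"
      using c1(2) H by blast
    have weak: "t * ?D f t powr (1 / p) \<le> c2 * H" if "0 < t" for t
      using c2(2) H' H(2) that by blast
    have B0: "0 \<le> c2 * H" and J0: "0 \<le> c1 * H" using c1 c2 H by auto
    have main: "4 * t * dfun (centered_max m M f) (4 * t) powr (1 / p) \<le> 4 * K powr (1 / p) * H" if t: "0 < t" for t
    proof -
      let ?u = "H powr p / t powr p"
      have "?D f t \<le> (c2 * H / t) powr p"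
        by (rule le_powr_if_root_le[OF dfun_nonneg t B0 weak[OF t]])
      then have 1: "2 * ?D f t \<le> 2 * c2 powr p * ?u"
        using c2 H t by (simp add: powr_mult powr_divide)
      have 2: "(if t < c1 * H / ?\<kappa> then measure M X else 0) \<le> measure M X * (c1 / ?\<kappa>) powr p * ?u"
      proof (cases "t < c1 * H / ?\<kappa>")
        case True
        \<comment> \<open>In this range the height of the constant term is at least
          \<open>t\<close>, so the total mass may be multiplied by the \<open>p\<close>-th power of
          their ratio.\<close>
        then have "1 powr p \<le> (c1 * H / ?\<kappa> / t) powr p"
          using t p0 by (intro powr_mono2) (auto simp only: le_divide_eq_1_pos less_imp_le)
        also have "\<dots> = (c1 / ?\<kappa>) powr p * ?u"
          using c1 H t by (simp add: powr_mult powr_divide)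
        finally have "measure M X * 1 \<le> measure M X * ((c1 / ?\<kappa>) powr p * ?u)"
          by (intro mult_left_mono) auto
        then show ?thesis using True by (simp add: mult.assoc)
      qed simp
      have 3: "source_part f t \<le> 2 * suminf a * c2 powr p * ?u"
      proof -
        have "ennreal (source_part f t) \<le> (\<Sum>k. ennreal (source_dist (c2 * H) k t))"
          by (rule source_part_le[OF t source_value_le[OF weak]])
        also have "\<dots> \<le> (\<Sum>k. ennreal (2 * (c2 * H / t) powr p * a k))"
          using source_dist_weak[OF t B0] by (intro suminf_le ennreal_leI) (auto simp: mult_ac)
        also have "\<dots> = ennreal (\<Sum>k. 2 * (c2 * H / t) powr p * a k)"
          using S a_pos[THEN less_imp_le] by (intro suminf_ennreal2 summable_mult mult_nonneg_nonneg) auto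
        also have "(\<Sum>k. 2 * (c2 * H / t) powr p * a k) = 2 * (c2 * H / t) powr p * suminf a"
          by (rule suminf_mult[OF S])
        finally have "source_part f t \<le> 2 * (c2 * H / t) powr p * suminf a"
          using S0 by (subst (asm) ennreal_le_iff) auto
        then show ?thesis using c2 H t by (simp add: powr_mult powr_divide mult_ac)
      qed
      have "dfun (centered_max m M f) (4 * t) \<le> K * ?u"
        using dfun_centered_max_le[OF J J0 t] 1 2 3 unfolding K_def distrib_right by linarith
      then have "dfun (centered_max m M f) (4 * t) powr (1 / p) \<le> (K * ?u) powr (1 / p)"
        using p0 by (intro powr_mono2) auto
      also have "\<dots> = K powr (1 / p) * (H / t)"
        using p0 K0 t H by (simp add: powr_mult powr_divide powr_powr)
      finally have "4 * t * dfun (centered_max m M f) (4 * t) powr (1 / p) \<le> 4 * t * (K powr (1 / p) * (H / t))"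
        using t by (intro mult_left_mono) auto
      then show ?thesis using t by simp
    qed
    have "lorentz_norm_enn M p \<infinity> (centered_max m M f) \<le> ennreal (4 * K powr (1 / p) * H)"
      unfolding lorentz_norm_enn_infinity[OF p0]
    proof (rule SUP_least)
      fix t :: real assume "t \<in> {0<..}"
      then show "ennreal (t * dfun (centered_max m M f) t powr (1 / p)) \<le> ennreal (4 * K powr (1 / p) * H)"
        using main[of "t / 4"] by (intro ennreal_leI) auto
    qed
    then show "lorentz_norm_enn M p \<infinity> (centered_max m M f) \<le> ennreal (4 * K powr (1 / p)) * lorentz_norm M p q f"
      using H by (simp add: ennreal_mult[symmetric])
  qed simp
qed

section \<open>Unboundedness tested on indicators of sources\<close>

lemma lorentz_norm_source:
  assumes "1 \<le> q"
  shows "\<exists>c\<ge>0. \<forall>k. lorentz_norm M p q (indicator {\<sigma> k}) \<le> ennreal (c * w (\<sigma> k) powr (1 / p))"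
proof -
  let ?D = "\<lambda>k. dfun (\<lambda>x. ennreal \<bar>indicator {\<sigma> k} x\<bar>)"
  have p0: "0 < p" using p_ge1 by simp
  \<comment> \<open>The distribution function of the indicator lives on heights below
    \<open>1\<close>, where it is at most \<open>w (\<sigma> k)\<close>. Thus the mass enters the
    norm only as \<open>w (\<sigma> k) powr (1 / p)\<close>.\<close>
  have D: "?D k t \<le> (if t < 1 then w (\<sigma> k) else 0)" if "0 < t" for k t
  proof -
    have "{x \<in> space M. ennreal t < ennreal \<bar>indicator {\<sigma> k} x\<bar>} \<subseteq> (if t < 1 then {\<sigma> k} else {})"
      using that by (auto simp: indicator_def ennreal_less_iff)
    then have "?D k t \<le> measure M (if t < 1 then {\<sigma> k} else {})"
      unfolding dfun_def using sigma_in by (intro finite_measure_mono) auto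
    also have "\<dots> = (if t < 1 then w (\<sigma> k) else 0)"
      using sigma_in by (simp add: measure_def less_imp_le)
    finally show ?thesis .
  qed
  show ?thesis
  proof (cases q)
    case (real q')
    then have q': "1 \<le> q'" using assms by (simp add: one_ereal_def)
    have "lorentz_integral p q' (?D k) \<le> ennreal (1 / q' * (w (\<sigma> k) powr (1 / p)) powr q')" for k
    proof -
      have "lorentz_integral p q' (?D k)
        \<le> (\<integral>\<^sup>+ t. ennreal (w (\<sigma> k) powr (q' / p)) * (ennreal (t powr (q' - 1)) * indicator {0<..<1} t) \<partial>lborel)"
        unfolding lorentz_integral_def
      proof (rule nn_integral_mono)
        fix t
        show "ennreal (t powr (q' - 1) * ?D k t powr (q' / p)) * indicator {0<..} t
          \<le> ennreal (w (\<sigma> k) powr (q' / p)) * (ennreal (t powr (q' - 1)) * indicator {0<..<1} t)"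
        proof (cases "0 < t")
          case True
          have "?D k t powr (q' / p) \<le> (if t < 1 then w (\<sigma> k) else 0) powr (q' / p)"
            using D[OF True] q' p0 by (intro powr_mono2) auto
          then have "t powr (q' - 1) * ?D k t powr (q' / p) \<le> t powr (q' - 1) * (if t < 1 then w (\<sigma> k) else 0) powr (q' / p)"
            by (rule mult_left_mono) simp
          then have "ennreal (t powr (q' - 1) * ?D k t powr (q' / p)) \<le> ennreal (t powr (q' - 1) * (if t < 1 then w (\<sigma> k) else 0) powr (q' / p))"
            by (rule ennreal_leI)
          then show ?thesis using True by (cases "t < 1") (simp_all add: ennreal_mult mult.commute)
        qed simp
      qed
      also have "\<dots> = ennreal (w (\<sigma> k) powr (q' / p)) * ennreal (1 powr q' / q')"
        using q' by (subst nn_integral_cmult) (auto simp: nn_integral_powr_from_0)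
      also have "\<dots> = ennreal (1 / q' * (w (\<sigma> k) powr (1 / p)) powr q')"
        using q' by (simp add: ennreal_mult[symmetric] powr_powr)
      finally show ?thesis .
    qed
    then have "lorentz_norm M p q (indicator {\<sigma> k}) \<le> ennreal ((p * (1 / q')) powr (1 / q')) * ennreal (w (\<sigma> k) powr (1 / p))" for k
      unfolding real lorentz_norm_def using q' p0 by (intro lorentz_norm_enn_real_leI) auto
    then have "\<forall>k. lorentz_norm M p q (indicator {\<sigma> k}) \<le> ennreal ((p * (1 / q')) powr (1 / q') * w (\<sigma> k) powr (1 / p))"
      by (simp add: ennreal_mult)
    then show ?thesis by (meson powr_ge_zero)
  next
    case PInf
    have "lorentz_norm M p q (indicator {\<sigma> k}) \<le> ennreal (1 * w (\<sigma> k) powr (1 / p))" for k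
      unfolding PInf lorentz_norm_def lorentz_norm_enn_infinity[OF p0]
    proof (intro SUP_least ennreal_leI)
      fix t :: real assume t: "t \<in> {0<..}"
      show "t * ?D k t powr (1 / p) \<le> 1 * w (\<sigma> k) powr (1 / p)"
      proof (cases "t < 1")
        case True
        then have "?D k t \<le> w (\<sigma> k)" using D[of t k] t by simp
        then show ?thesis using True t p0 by (intro mult_mono powr_mono2) auto
      next
        case False
        then have "?D k t = 0" using D[of t k] t dfun_nonneg[of _ t] by (intro antisym) auto
        then show ?thesis by simp
      qed
    qed
    then show ?thesis by (intro exI[of _ "1::real"]) auto
  qed (use assms in simp)
qed

text \<open>On level \<open>i\<close> the target and the source each weigh at most as much as the
  dummy, so the average over the triple is at least \<open>1 / (3 * 2 ^ i)\<close>. This single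
  level already has the required mass.\<close>

lemma dfun_centered_max_ge:
  assumes "i < N k" "t < 1 / (3 * 2 ^ i)"
  shows "w (\<sigma> k) * a k * (2 powr p) ^ i \<le> dfun (centered_max m M (indicator {\<sigma> k})) t"
  unfolding measure_L[OF assms(1), symmetric] dfun_def
proof (intro finite_measure_mono subsetI)
  fix x assume x: "x \<in> L k i"
  then have xT: "x \<in> T" using L_subset[OF assms(1)] by auto
  have xX: "x \<in> X" using xT T_subset by auto
  have sx: "s x = \<sigma> k" by (rule s_L[OF assms(1) x])
  have wz: "w (z x) = w (\<sigma> k) * 2 ^ i" by (rule w_L[OF assms(1) x])
  have pos: "0 < w x" "0 < w (\<sigma> k)" using w_pos xX sigma_in by auto
  have "w (\<sigma> k) * 1 \<le> w (\<sigma> k) * 2 ^ i"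
    by (intro mult_left_mono less_imp_le[OF w_sigma_pos]) auto
  then have w_ge: "w (\<sigma> k) \<le> w (\<sigma> k) * 2 ^ i"
    by (simp only: mult_1_right)
  have "w x + w (z x) + w (\<sigma> k) \<le> w (\<sigma> k) * (3 * 2 ^ i)"
    using w_le[OF xT] wz w_ge by linarith
  then have "w (\<sigma> k) / (w (\<sigma> k) * (3 * 2 ^ i)) \<le> w (\<sigma> k) / (w x + w (z x) + w (\<sigma> k))"
    using pos(1) wz by (intro divide_left_mono mult_pos_pos add_pos_pos) (auto intro: less_imp_le)
  moreover have "w (\<sigma> k) / (w (\<sigma> k) * (3 * 2 ^ i)) = 1 / (3 * 2 ^ i)" by simp
  ultimately have "ennreal t < ennreal (w (s x) / (w x + w (z x) + w (s x)))"
    using assms(2) unfolding sx by (intro ennreal_lessI) (auto intro: less_le_trans simp: pos wz add_pos_pos)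
  also note centered_max_ge[OF xT]
  finally show "x \<in> {x \<in> space M. ennreal t < centered_max m M (indicator {\<sigma> k}) x}"
    using xX sx by simp
qed auto

text \<open>Each of the \<open>N k\<close> levels adds
  \<open>6 powr (- r) * (w (\<sigma> k) * a k) powr (r / p)\<close> to the integral, as halving the
  height is balanced by the growth \<open>2 powr p\<close> of the level masses. Taking the
  \<open>r\<close>-th root produces \<open>N k powr (1 / r)\<close>.\<close>

lemma lorentz_norm_centered_max_ge:
  assumes "1 \<le> r"
  shows "ennreal ((w (\<sigma> k) * a k) powr (1 / p) * N k powr inv_exponent r / 6)
    \<le> lorentz_norm_enn M p r (centered_max m M (indicator {\<sigma> k}))"
proof -
  let ?F = "dfun (centered_max m M (indicator {\<sigma> k}))"
  let ?A = "w (\<sigma> k) * a k"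
  have A: "0 < ?A" using a_pos[of k] by simp
  have p0: "0 < p" using p_ge1 by simp
  show ?thesis
  proof (cases r)
    case (real r')
    then have r': "1 \<le> r'" using assms by (simp add: one_ereal_def)
    let ?e = "r' / p"
    \<comment> \<open>These disjoint intervals lie just below the heights reached on the respective
      levels. Each is as long as its left endpoint, so integrating \<open>t powr (r' - 1)\<close>
      over it gives at least the \<open>r'\<close>-th power of that endpoint.\<close>
    define I where "I i = {1 / (6 * 2 ^ i)<..<1 / (3 * 2 ^ i :: real)}" for i :: nat
    define c where "c i = (1 / (6 * 2 ^ i)) powr (r' - 1) * (?A * (2 powr p) ^ i) powr ?e" for i :: nat
    have disj: "i = j" if "t \<in> I i" "t \<in> I j" for i j t
    proof (rule ccontr)
      have less: False if "i < j" "t \<in> I i" "t \<in> I j" for i j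
      proof -
        have "2 * 2 ^ i \<le> (2 ^ j :: real)"
          using that(1) power_increasing[of "Suc i" j "2::real"] by simp
        then have "1 / (3 * 2 ^ j) \<le> 1 / (6 * 2 ^ i :: real)" by (simp add: field_simps)
        with that(2,3) show False by (simp add: I_def)
      qed
      assume "i \<noteq> j"
      then show False using less[of i j] less[of j i] that by (cases "i < j") auto
    qed
    have c0: "0 \<le> c i" for i by (simp add: c_def)
    have pointwise: "(\<Sum>i<N k. ennreal (c i) * indicator (I i) t)
      \<le> ennreal (t powr (r' - 1) * ?F t powr ?e) * indicator {0<..} t" for t
    proof (cases "\<exists>n<N k. t \<in> I n")
      case True
      then obtain n where n: "n < N k" "t \<in> I n" by blast
      have "(\<Sum>i<N k. ennreal (c i) * indicator (I i) t) = (\<Sum>i\<in>{n}. ennreal (c i) * indicator (I i) t)"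
        using n disj by (intro sum.mono_neutral_right) (auto simp: indicator_def)
      also have "\<dots> = ennreal (c n)" using n by simp
      also have "c n \<le> t powr (r' - 1) * ?F t powr ?e"
        unfolding c_def
      proof (intro mult_mono powr_mono2)
        show "?A * (2 powr p) ^ n \<le> ?F t"
          using n by (intro dfun_centered_max_ge) (auto simp: I_def)
      qed (use n r' p0 A in \<open>auto simp: I_def less_imp_le\<close>)
      also have "0 < t" using n by (auto simp: I_def intro: le_less_trans[rotated])
      ultimately show ?thesis by (simp add: ennreal_leI)
    next
      case False
      then have "(\<Sum>i<N k. ennreal (c i) * indicator (I i) t) = 0"
        by (intro sum.neutral) (auto simp: indicator_def)
      then show ?thesis by simp
    qed
    have "(\<integral>\<^sup>+ t. (\<Sum>i<N k. ennreal (c i) * indicator (I i) t) \<partial>lborel)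
      = (\<Sum>i<N k. \<integral>\<^sup>+ t. ennreal (c i) * indicator (I i) t \<partial>lborel)"
      by (intro nn_integral_sum) (simp add: I_def)
    also have "\<dots> = (\<Sum>i<N k. ennreal (6 powr (- r') * ?A powr ?e))"
    proof (intro sum.cong refl)
      fix i
      let ?b = "1 / (6 * 2 ^ i) :: real"
      have "(\<integral>\<^sup>+ t. ennreal (c i) * indicator (I i) t \<partial>lborel) = ennreal (c i) * emeasure lborel (I i)"
        by (rule nn_integral_cmult_indicator) (simp add: I_def)
      also have "emeasure lborel (I i) = ennreal ?b"
        unfolding I_def by (subst emeasure_lborel_Ioo) (auto simp: field_simps)
      also have "ennreal (c i) * ennreal ?b = ennreal (c i * ?b)"
        using c0 by (intro ennreal_mult[symmetric]) auto
      also have "c i * ?b = 6 powr (- r') * ?A powr ?e"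
      proof -
        have "(?A * (2 powr p) ^ i) powr ?e = ?A powr ?e * (2 ^ i) powr r'"
        proof -
          have "((2 powr p) ^ i) powr ?e = (2 ^ i) powr r'"
            using p0 by (simp add: powr_realpow[symmetric] powr_powr mult_ac)
          then show ?thesis using A by (simp only: powr_mult)
        qed
        moreover have "?b powr (r' - 1) * ?b = 6 powr (- r') * (2 ^ i) powr (- r')"
          by (simp add: powr_diff powr_divide powr_mult powr_minus field_simps)
        moreover have "c i * ?b = (?b powr (r' - 1) * ?b) * (?A * (2 powr p) ^ i) powr ?e"
          unfolding c_def by (simp only: mult_ac)
        ultimately have "c i * ?b = 6 powr (- r') * ?A powr ?e * ((2 ^ i) powr (- r') * (2 ^ i) powr r')"
          by (simp only: mult_ac)
        then show ?thesis by (simp add: powr_minus)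
      qed
      finally show "(\<integral>\<^sup>+ t. ennreal (c i) * indicator (I i) t \<partial>lborel) = ennreal (6 powr (- r') * ?A powr ?e)" .
    qed
    also have "\<dots> = ennreal (N k * (6 powr (- r') * ?A powr ?e))"
      by (simp add: ennreal_mult ennreal_of_nat_eq_real_of_nat)
    finally have "ennreal (N k * (6 powr (- r') * ?A powr ?e)) = (\<integral>\<^sup>+ t. (\<Sum>i<N k. ennreal (c i) * indicator (I i) t) \<partial>lborel)" ..
    also have "\<dots> \<le> lorentz_integral p r' ?F"
      unfolding lorentz_integral_def by (intro nn_integral_mono pointwise)
    finally have "ennreal (N k * (6 powr (- r') * ?A powr ?e)) \<le> lorentz_integral p r' ?F" .
    then have "ennreal ((N k * (6 powr (- r') * ?A powr ?e)) powr (1 / r')) \<le> ennpowr (lorentz_integral p r' ?F) (1 / r')"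
      using r' by (intro ennpowr_mono) auto
    also have "(N k * (6 powr (- r') * ?A powr ?e)) powr (1 / r') = ?A powr (1 / p) * N k powr (1 / r') / 6"
    proof -
      have "(N k * (6 powr (- r') * ?A powr ?e)) powr (1 / r')
        = N k powr (1 / r') * ((6 powr (- r')) powr (1 / r') * (?A powr ?e) powr (1 / r'))"
        by (simp only: powr_mult)
      also have "(6 powr (- r')) powr (1 / r') = (1 / 6 :: real)"
      proof -
        have "- r' * (1 / r') = - 1" using r' by simp
        then show ?thesis by (simp only: powr_powr) (simp add: powr_minus_divide)
      qed
      also have "(?A powr ?e) powr (1 / r') = ?A powr (1 / p)"
        using r' by (simp add: powr_powr)
      finally show ?thesis by simp
    qed
    also have "ennpowr (lorentz_integral p r' ?F) (1 / r') = 1 * ennpowr (lorentz_integral p r' ?F) (1 / r')" by simp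
    also have "\<dots> \<le> ennreal (p powr (1 / r')) * ennpowr (lorentz_integral p r' ?F) (1 / r')"
      using p_ge1 r' by (intro mult_right_mono) (auto simp: ge_one_powr_ge_zero)
    also have "\<dots> = lorentz_norm_enn M p r (centered_max m M (indicator {\<sigma> k}))"
      unfolding real using p0 r' by (intro lorentz_norm_enn_real[symmetric]) auto
    finally show ?thesis using real by (simp add: inv_exponent_def)
  next
    case PInf
    \<comment> \<open>For the supremum one level is enough: level \<open>0\<close> reaches height
      \<open>1 / 3\<close>, and \<open>1 / 4\<close> lies between \<open>1 / 6\<close> and
      \<open>1 / 3\<close>.\<close>
    have "?A \<le> ?F (1 / 4)"
      using dfun_centered_max_ge[of 0 k "1 / 4"] N_pos[of k] by simp
    then have "?A powr (1 / p) \<le> ?F (1 / 4) powr (1 / p)"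
      using A p0 by (intro powr_mono2) auto
    then have "?A powr (1 / p) / 6 \<le> 1 / 4 * ?F (1 / 4) powr (1 / p)" 
      using powr_ge_zero[of ?A "1 / p"] by linarith
    then have "ennreal (?A powr (1 / p) / 6) \<le> ennreal (1 / 4 * ?F (1 / 4) powr (1 / p))"
      by (rule ennreal_leI)
    also have "\<dots> \<le> lorentz_norm_enn M p r (centered_max m M (indicator {\<sigma> k}))"
      unfolding PInf lorentz_norm_enn_infinity[OF p0] by (rule SUP_upper) simp
    finally show ?thesis using PInf N_pos[of k] by (simp add: inv_exponent_def)
  qed (use assms in simp)
qed

text \<open>In the quotient of the norms for the indicator of \<open>\<sigma> k\<close> the factor
  \<open>w (\<sigma> k) powr (1 / p)\<close> cancels, leaving
  \<open>a k powr (1 / p) * N k powr inv_exponent r\<close> up to a constant.\<close>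

lemma max_const_eq_top:
  assumes "1 \<le> q" "1 \<le> r" and unbounded: "\<And>C. \<exists>k. C < a k powr (1 / p) * N k powr inv_exponent r"
  shows "max_const p q r m M = \<infinity>"
proof -
  from lorentz_norm_source[OF assms(1)] obtain c where c: "0 \<le> c"
    "\<And>k. lorentz_norm M p q (indicator {\<sigma> k}) \<le> ennreal (c * w (\<sigma> k) powr (1 / p))" by blast
  have "C = \<infinity>" if C: "\<forall>f\<in>lorentz_space M p q.
      lorentz_norm_enn M p r (centered_max m M f) \<le> C * lorentz_norm M p q f" for C
  proof (cases C)
    case (real C')
    obtain k where k: "6 * (C' * c) < a k powr (1 / p) * N k powr inv_exponent r"
      using unbounded by blast
    let ?w = "w (\<sigma> k) powr (1 / p)"
    have "lorentz_norm M p q (indicator {\<sigma> k}) < \<infinity>"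
      using c(2)[of k] by (rule le_less_trans) simp
    then have "indicator {\<sigma> k} \<in> lorentz_space M p q"
      by (simp add: lorentz_space_def borel_measurable_all)
    then have "lorentz_norm_enn M p r (centered_max m M (indicator {\<sigma> k})) \<le> C * ennreal (c * ?w)"
      using C c(2)[of k] by (meson mult_left_mono order_trans zero_le)
    with lorentz_norm_centered_max_ge[OF assms(2), of k]
    have "ennreal ((w (\<sigma> k) * a k) powr (1 / p) * N k powr inv_exponent r / 6) \<le> C * ennreal (c * ?w)"
      by (rule order_trans)
    also have "\<dots> = ennreal (C' * (c * ?w))"
      using real c(1) by (simp add: ennreal_mult)
    finally have "(w (\<sigma> k) * a k) powr (1 / p) * N k powr inv_exponent r / 6 \<le> C' * (c * ?w)"
      using real c(1) by (subst (asm) ennreal_le_iff) auto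
    moreover have "(w (\<sigma> k) * a k) powr (1 / p) = ?w * a k powr (1 / p)"
      using a_pos[of k] by (simp add: powr_mult less_imp_le)
    ultimately have "?w * (a k powr (1 / p) * N k powr inv_exponent r) \<le> ?w * (6 * (C' * c))"
      by (simp add: mult_ac)
    then have "a k powr (1 / p) * N k powr inv_exponent r \<le> 6 * (C' * c)"
      by (rule mult_left_le_imp_le) simp
    with k show ?thesis by simp
  qed simp
  \<comment> \<open>Whether this set is empty or equal to \<open>{\<infinity>}\<close>, its infimum
    is \<open>\<infinity>\<close>.\<close>
  then have "{C. \<forall>f\<in>lorentz_space M p q.
      lorentz_norm_enn M p r (centered_max m M f) \<le> C * lorentz_norm M p q f} \<subseteq> {\<infinity>}" by blast
  then show ?thesis unfolding max_const_def by (auto simp: subset_singleton_iff)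
qed

text \<open>A target on level \<open>0\<close> has a dummy exactly as heavy as its source, so its
  triple weighs at most \<open>3 * w (\<sigma> k)\<close>, which tends to zero.\<close>

lemma not_doubling_level_graph:
  assumes "\<And>k. w (\<sigma> k) \<le> (1 / 2) ^ k"
  shows "\<not> doubling m M"
proof (rule not_doubling_graph)
  fix e :: real assume "0 < e"
  then obtain k where k: "(1 / 2) ^ k < e / 3"
    using real_arch_pow_inv[of "e / 3" "1 / 2"] by auto
  have "measure M (L k 0) \<noteq> 0"
    using measure_L[OF N_pos[of k]] a_pos[of k] by simp
  then obtain x where x: "x \<in> L k 0" by (metis all_not_in_conv measure_empty)
  then have xT: "x \<in> T" using L_subset[OF N_pos] by blast
  have "w x + w (z x) + w (s x) \<le> 3 * w (\<sigma> k)"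
    using w_le[OF xT] w_L[OF N_pos x] s_L[OF N_pos x] by simp
  also have "\<dots> < e" using assms[of k] k by simp
  finally show "\<exists>x\<in>T. w x + w (z x) + w (s x) < e" using xT by blast
qed

end

subsection \<open>Construction of the spaces\<close>

text \<open>Points \<open>(tag, k, i, j)\<close> with tag \<open>0\<close> for the source, \<open>1\<close> for the dummies \<open>z x\<close> and \<open>2\<close> for the
  targets \<open>x\<close>. Level \<open>(k, i)\<close> is split into enough targets to make each of them lighter than its dummy,
  and the masses \<open>\<mu> k\<close> of the sources are so small that the total mass is finite.\<close>

lemma ex_level_graph:
  fixes a :: "nat \<Rightarrow> real"
  assumes p: "1 \<le> p" and a: "\<And>k. 0 < a k" and N: "\<And>k. 0 < N k"
  shows "\<exists>(X :: real set) T z s w \<sigma> L. level_graph X T z s w p \<sigma> a N L \<and> (\<forall>k. w (\<sigma> k) \<le> (1 / 2) ^ k)"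
proof -
  \<comment> \<open>The points must be reals, so index tuples are coded as natural numbers inside
    the reals; \<open>enc\<close> carries no metric meaning.\<close>
  define enc :: "nat \<times> nat \<times> nat \<times> nat \<Rightarrow> real" where "enc e = real (to_nat e)" for e
  define dec where "dec = inv enc"
  have inj: "inj enc" by (auto simp: enc_def inj_def)
  then have dec [simp]: "dec (enc e) = e" for e by (simp add: dec_def)
  have enc_eq [simp]: "enc e = enc e' \<longleftrightarrow> e = e'" for e e' using inj by (simp add: inj_eq)
  \<comment> \<open>A level of relative mass \<open>a k * (2 powr p) ^ i\<close> split into
    \<open>n k i\<close> equal targets must have pieces no heavier than the dummy mass
    \<open>2 ^ i\<close>.\<close>
  define n where "n k i = nat \<lceil>a k * (2 ^ i) powr (p - 1)\<rceil>" for k i :: nat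
  have n_ge: "a k * (2 ^ i) powr (p - 1) \<le> n k i" for k i
    unfolding n_def by (rule of_nat_ceiling)
  have n_pos: "0 < n k i" for k i
  proof -
    have "0 < a k * (2 ^ i) powr (p - 1)" using a[of k] by simp
    with n_ge[of k i] show ?thesis by linarith
  qed
  \<comment> \<open>\<open>S k\<close> is the mass of component \<open>k\<close>, dummies included,
    relative to its source; dividing by it gives the component total mass
    \<open>(1 / 2) ^ k\<close>.\<close>
  define S where "S k = 1 + (\<Sum>i<N k. a k * (2 powr p) ^ i + n k i * 2 ^ i)" for k
  define \<mu> where "\<mu> k = (1 / 2) ^ k / S k" for k
  have S_ge: "1 \<le> S k" for k
  proof -
    have "0 \<le> (\<Sum>i<N k. a k * (2 powr p) ^ i + n k i * 2 ^ i)"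
      using less_imp_le[OF a[of k]] by (intro sum_nonneg add_nonneg_nonneg mult_nonneg_nonneg) auto
    then show ?thesis by (simp add: S_def)
  qed
  have mu_pos: "0 < \<mu> k" for k using S_ge[of k] by (simp add: \<mu>_def)
  define w where "w x = (case dec x of (t, k, i, j) \<Rightarrow>
      if t = 0 then \<mu> k else if t = 1 then \<mu> k * 2 ^ i else \<mu> k * a k * (2 powr p) ^ i / n k i)" for x
  define z where "z x = (case dec x of (t, k, i, j) \<Rightarrow> enc (1, k, i, j))" for x
  define s where "s x = (case dec x of (t, k, i, j) \<Rightarrow> enc (0, k, 0, 0))" for x
  define \<sigma> where "\<sigma> k = enc (0, k, 0, 0)" for k
  define L where "L k i = (\<lambda>j. enc (2, k, i, j)) ` {..<n k i}" for k i
  define Z where "Z k i = (\<lambda>j. enc (1, k, i, j)) ` {..<n k i}" for k i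
  define T where "T = (\<Union>k. \<Union>i\<in>{..<N k}. L k i)"
  define Y where "Y k = insert (\<sigma> k) (\<Union>i\<in>{..<N k}. L k i \<union> Z k i)" for k
  define X where "X = (\<Union>k. Y k)"
  let ?P = "point_measure X (\<lambda>x. ennreal (w x))"
  have w_sigma: "w (\<sigma> k) = \<mu> k" for k by (simp add: w_def \<sigma>_def)
  have wL: "w (enc (2, k, i, j)) = \<mu> k * a k * (2 powr p) ^ i / n k i" for k i j by (simp add: w_def)
  have wZ: "w (enc (1, k, i, j)) = \<mu> k * 2 ^ i" for k i j by (simp add: w_def)
  have w_pos: "0 < w x" for x
    using mu_pos a n_pos by (auto simp: w_def split: prod.split)
  have TX: "T \<subseteq> X" by (auto simp: T_def X_def Y_def)
  have LX: "L k i \<subseteq> X" "Z k i \<subseteq> X" if "i < N k" for k i using that by (auto simp: X_def Y_def)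
  have sigma: "\<sigma> k \<in> X" "\<sigma> k \<notin> T" for k by (auto simp: X_def Y_def T_def L_def \<sigma>_def)
  have finY: "finite (Y k)" and YX: "Y k \<subseteq> X" for k by (auto simp: X_def Y_def L_def Z_def)
  have T_elim: "\<exists>k i j. x = enc (2, k, i, j) \<and> i < N k \<and> j < n k i" if "x \<in> T" for x
    using that by (auto simp: T_def L_def)
  have z_in: "z x \<in> X - T" "s x \<in> X - T" "z x \<noteq> s x" "w x \<le> w (z x)" if xT: "x \<in> T" for x
  proof -
    obtain k i j where x: "x = enc (2, k, i, j)" "i < N k" "j < n k i" using T_elim[OF xT] by blast
    have "enc (1, k, i, j) \<in> X" using x by (auto simp: X_def Y_def Z_def)
    moreover have "enc (1, k, i, j) \<notin> T" by (auto simp: T_def L_def)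
    ultimately show "z x \<in> X - T" by (simp add: z_def x)
    show "s x \<in> X - T" using sigma[of k] by (simp add: s_def x \<sigma>_def)
    show "z x \<noteq> s x" by (simp add: s_def z_def x)
    have "(2 powr p) ^ i = (2 ^ i) powr (p - 1) * 2 ^ i"
      by (simp add: powr_diff powr_realpow[symmetric] powr_powr mult.commute)
    then have "a k * (2 powr p) ^ i \<le> n k i * 2 ^ i"
      using mult_right_mono[OF n_ge[of k i], of "2 ^ i"] by (simp add: mult.assoc)
    then have "a k * (2 powr p) ^ i / n k i \<le> 2 ^ i"
      using n_pos[of k i] by (simp add: divide_le_eq mult.commute)
    then have "\<mu> k * (a k * (2 powr p) ^ i / n k i) \<le> \<mu> k * 2 ^ i"
      using mu_pos[of k] by (intro mult_left_mono) auto
    then show "w x \<le> w (z x)" by (simp add: w_def z_def x)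
  qed
  have inj_z: "inj_on z T"
    by (rule inj_onI) (auto simp: z_def dest!: T_elim)
  have em: "emeasure ?P A = ennreal (\<Sum>x\<in>A. w x)" if "finite A" "A \<subseteq> X" for A
    using that w_pos by (subst emeasure_point_measure_finite2) (auto intro!: sum_ennreal less_imp_le)
  have sumL: "(\<Sum>x\<in>L k i. w x) = \<mu> k * a k * (2 powr p) ^ i" for k i
    unfolding L_def using n_pos[of k i] by (subst sum.reindex) (auto simp: inj_on_def wL)
  have sumZ: "(\<Sum>x\<in>Z k i. w x) = \<mu> k * (n k i * 2 ^ i)" for k i
    unfolding Z_def using n_pos[of k i] by (subst sum.reindex) (auto simp: inj_on_def wZ[simplified])
  have sumY: "(\<Sum>x\<in>Y k. w x) \<le> (1 / 2) ^ k" for k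
  proof -
    have fin: "finite (L k i)" "finite (Z k i)" for i by (simp_all add: L_def Z_def)
    have LZ: "L k i \<inter> Z k i = {}" for i by (auto simp: L_def Z_def)
    have "\<sigma> k \<notin> (\<Union>i\<in>{..<N k}. L k i \<union> Z k i)" by (auto simp: \<sigma>_def L_def Z_def)
    then have "(\<Sum>x\<in>Y k. w x) = w (\<sigma> k) + (\<Sum>x\<in>(\<Union>i\<in>{..<N k}. L k i \<union> Z k i). w x)"
      unfolding Y_def using fin by (intro sum.insert) auto
    also have "(\<Sum>x\<in>(\<Union>i\<in>{..<N k}. L k i \<union> Z k i). w x) = (\<Sum>i<N k. \<Sum>x\<in>L k i \<union> Z k i. w x)"
      using fin by (intro sum.UNION_disjoint) (auto simp: L_def Z_def)
    also have "\<dots> = (\<Sum>i<N k. \<mu> k * (a k * (2 powr p) ^ i + n k i * 2 ^ i))"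
    proof (intro sum.cong refl)
      fix i
      have "(\<Sum>x\<in>L k i \<union> Z k i. w x) = (\<Sum>x\<in>L k i. w x) + (\<Sum>x\<in>Z k i. w x)"
        by (rule sum.union_disjoint[OF fin LZ])
      then show "(\<Sum>x\<in>L k i \<union> Z k i. w x) = \<mu> k * (a k * (2 powr p) ^ i + n k i * 2 ^ i)"
        by (simp add: sumL sumZ distrib_left mult.assoc)
    qed
    also have "w (\<sigma> k) + \<dots> = \<mu> k * S k"
      by (simp add: w_sigma S_def distrib_left sum_distrib_left)
    also have "\<dots> = (1 / 2) ^ k" using S_ge[of k] by (simp add: \<mu>_def)
    finally show ?thesis by simp
  qed
  have "emeasure ?P X \<le> (\<Sum>k. emeasure ?P (Y k))"
    unfolding X_def using YX by (intro emeasure_subadditive_countably) (auto simp: sets_point_measure X_def)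
  also have "\<dots> \<le> (\<Sum>k. ennreal ((1 / 2) ^ k))"
    using em[OF finY YX] sumY by (intro suminf_le) (auto intro!: ennreal_leI)
  also have "\<dots> = ennreal (\<Sum>k. (1 / 2) ^ k)"
    by (intro suminf_ennreal2) (auto intro: summable_geometric)
  also have "\<dots> < \<infinity>" by simp
  finally have fin: "emeasure ?P X \<noteq> \<infinity>" by simp
  interpret clique_graph X T z s w
    by unfold_locales (use TX sigma z_in inj_z w_pos fin in auto)
  have "level_graph X T z s w p \<sigma> a N L"
  proof
    show "T = (\<Union>k. \<Union>i\<in>{..<N k}. L k i)" by (rule T_def)
    show "s x = \<sigma> k" "w (z x) = w (\<sigma> k) * 2 ^ i" if "i < N k" "x \<in> L k i" for i k x
      using that by (auto simp: L_def s_def z_def \<sigma>_def w_def)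
    show "measure M (L k i) = w (\<sigma> k) * a k * (2 powr p) ^ i" if "i < N k" for i k
    proof -
      have "emeasure M (L k i) = ennreal (\<mu> k * a k * (2 powr p) ^ i)"
        unfolding sumL[symmetric] using LX(1)[OF that] by (intro emeasure_M_finite) (auto simp: L_def)
      then show ?thesis
        using mu_pos[of k] a[of k] by (simp add: measure_def w_sigma less_imp_le)
    qed
  qed (use p a N sigma in auto)
  moreover have "w (\<sigma> k) \<le> (1 / 2) ^ k" for k
    using S_ge[of k] by (simp add: w_sigma \<mu>_def divide_le_eq mult_le_cancel_left1)
  ultimately show ?thesis by blast
qed

section \<open>Sequences with quadratic exponents\<close>

lemma summable_powr_quadratic:
  fixes \<beta> \<gamma> :: real
  assumes "0 < \<gamma> \<or> 0 \<le> \<gamma> \<and> \<beta> < 0"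
  shows "summable (\<lambda>k::nat. 2 powr (\<beta> * k - \<gamma> * (real k)\<^sup>2))"
proof -
  have "\<exists>(C::real) (b::real). b < 0 \<and> (\<forall>k::nat. \<beta> * k - \<gamma> * (real k)\<^sup>2 \<le> C + b * k)"
  proof (cases "0 < \<gamma>")
    case True
    \<comment> \<open>Completing the square bounds the concave parabola by a line of slope
      \<open>- 1\<close>, so the series is dominated by a geometric one.\<close>
    have "\<beta> * k - \<gamma> * (real k)\<^sup>2 \<le> (\<beta> + 1)\<^sup>2 / (4 * \<gamma>) + (- 1 :: real) * k" for k :: nat
    proof -
      have "0 \<le> (2 * \<gamma> * k - (\<beta> + 1))\<^sup>2 / (4 * \<gamma>)" using True by simp
      also have "\<dots> = \<gamma> * (real k)\<^sup>2 - (\<beta> + 1) * k + (\<beta> + 1)\<^sup>2 / (4 * \<gamma>)"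
        using True by (simp add: power2_eq_square field_simps)
      finally show ?thesis by (simp add: algebra_simps)
    qed
    then show ?thesis by (intro exI[of _ "(\<beta> + 1)\<^sup>2 / (4 * \<gamma>)"] exI[of _ "- 1"]) auto
  next
    case False
    with assms have "\<beta> < 0" "\<gamma> = 0" by auto
    then show ?thesis by (intro exI[of _ "0::real"] exI[of _ \<beta>]) auto
  qed
  then obtain C b :: real where b: "b < 0" "\<And>k::nat. \<beta> * k - \<gamma> * (real k)\<^sup>2 \<le> C + b * k" by blast
  have "summable (\<lambda>k. 2 powr C * (2 powr b) ^ k)"
    using b(1) by (intro summable_mult summable_geometric) (simp add: powr_less_one)
  then show ?thesis
  proof (rule summable_comparison_test')
    fix k :: nat
    have "2 powr (\<beta> * k - \<gamma> * (real k)\<^sup>2) \<le> 2 powr (C + b * k)"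
      using b(2)[of k] by (intro powr_mono) auto
    also have "\<dots> = 2 powr C * (2 powr b) ^ k"
      by (simp add: powr_add powr_realpow[symmetric] powr_powr)
    finally show "norm (2 powr (\<beta> * k - \<gamma> * (real k)\<^sup>2)) \<le> 2 powr C * (2 powr b) ^ k" by simp
  qed
qed

lemma powr_quadratic_unbounded:
  fixes \<beta> \<gamma> C :: real
  assumes "0 < \<gamma> \<or> 0 \<le> \<gamma> \<and> 0 < \<beta>"
  shows "\<exists>k::nat. C < 2 powr (\<beta> * k + \<gamma> * (real k)\<^sup>2)"
proof -
  \<comment> \<open>An exponent of this size suffices, because
    \<open>2 powr x \<ge> 1 + x * ln 2\<close> and \<open>ln 2 \<ge> 2 / 3\<close>.\<close>
  have "\<exists>k::nat. 2 * \<bar>C\<bar> + 2 < \<beta> * k + \<gamma> * (real k)\<^sup>2"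
  proof (cases "0 < \<gamma>")
    case True
    obtain k :: nat where k: "k > (\<bar>\<beta>\<bar> + 2 * \<bar>C\<bar> + 2) / \<gamma>" using reals_Archimedean2 by blast
    have k1: "1 \<le> k" using k True by (cases k) (auto simp: field_simps)
    have "\<bar>\<beta>\<bar> + 2 * \<bar>C\<bar> + 2 < \<gamma> * k" using k True by (simp add: field_simps)
    then have "2 * \<bar>C\<bar> + 2 < \<beta> + \<gamma> * k" by linarith
    also have "\<dots> = 1 * (\<beta> + \<gamma> * k)" by simp
    also have "\<dots> \<le> k * (\<beta> + \<gamma> * k)"
      using k1 calculation by (intro mult_right_mono) auto
    finally show ?thesis by (intro exI[of _ k]) (simp add: power2_eq_square algebra_simps)
  next
    case False
    with assms have "0 < \<beta>" "\<gamma> = 0" by auto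
    moreover obtain k :: nat where "k > (2 * \<bar>C\<bar> + 2) / \<beta>" using reals_Archimedean2 by blast
    ultimately show ?thesis by (intro exI[of _ k]) (simp add: field_simps)
  qed
  then obtain k :: nat where k: "2 * \<bar>C\<bar> + 2 < \<beta> * k + \<gamma> * (real k)\<^sup>2" by blast
  have "C < 1 + 2 / 3 * (2 * \<bar>C\<bar> + 2)" by (simp add: abs_if field_simps)
  also have "\<dots> \<le> 1 + ln 2 * (2 * \<bar>C\<bar> + 2)"
    using ln2_ge_two_thirds by (intro add_left_mono mult_right_mono) auto
  also have "\<dots> \<le> 2 powr (2 * \<bar>C\<bar> + 2)"
    unfolding powr_def using exp_ge_add_one_self[of "(2 * \<bar>C\<bar> + 2) * ln 2"] by (simp add: mult.commute)
  also have "\<dots> \<le> 2 powr (\<beta> * k + \<gamma> * (real k)\<^sup>2)" using k by (intro powr_mono) auto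
  finally show ?thesis by blast
qed

text \<open>\<open>\<rho>\<close> is the reciprocal of the critical exponent and
  \<open>\<delta>\<close> a correction visible only there: the test quantity is \<open>2 powr
  (\<delta> * k + (inv_exponent r - \<rho>) * (real k)\<^sup>2)\<close>, whose linear term matters
  exactly when the quadratic one vanishes.\<close>

lemma ex_space:
  fixes p \<delta> \<rho> :: real
  assumes pq: "p = 1 \<and> q = 1 \<or> 1 < p \<and> 1 \<le> q"
  shows "\<exists>(m :: real metric) M. mms m M \<and> \<not> doubling m M
    \<and> (\<forall>r. 1 \<le> r \<and> (\<rho> < inv_exponent r \<or> \<rho> \<le> inv_exponent r \<and> 0 < \<delta>) \<longrightarrow> max_const p q r m M = \<infinity>)
    \<and> (\<forall>r. q \<le> r \<and> (inv_exponent r < \<rho> \<or> inv_exponent r \<le> \<rho> \<and> \<delta> < - 1) \<longrightarrow> max_const p q r m M < \<infinity>)"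
proof -
  define a where "a k = 2 powr (p * (\<delta> * k - \<rho> * (real k)\<^sup>2))" for k :: nat
  define N :: "nat \<Rightarrow> nat" where "N k = 2 ^ (k\<^sup>2)" for k
  have p: "1 \<le> p" and q: "1 \<le> q" using pq by auto
  have N_real: "real (N k) = 2 powr ((real k)\<^sup>2)" for k by (simp add: N_def powr_realpow[symmetric])
  obtain X :: "real set" and T z s w \<sigma> L where G: "level_graph X T z s w p \<sigma> a N L" "\<And>k. w (\<sigma> k) \<le> (1 / 2) ^ k"
    using ex_level_graph[of p a N] p by (auto simp: a_def N_def)
  interpret level_graph X T z s w p \<sigma> a N L by (rule G)
  show ?thesis
  proof (intro exI conjI allI impI)
    show "mms m M" by (rule mms_graph)
    show "\<not> doubling m M" by (rule not_doubling_level_graph[OF G(2)])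
    show "max_const p q r m M = \<infinity>" if r: "1 \<le> r \<and> (\<rho> < inv_exponent r \<or> \<rho> \<le> inv_exponent r \<and> 0 < \<delta>)" for r
    proof (rule max_const_eq_top[OF q])
      fix C :: real
      have "a k powr (1 / p) * N k powr inv_exponent r = 2 powr (\<delta> * k + (inv_exponent r - \<rho>) * (real k)\<^sup>2)" for k
        using p by (simp add: a_def N_real powr_powr powr_add[symmetric] algebra_simps)
      then show "\<exists>k. C < a k powr (1 / p) * N k powr inv_exponent r"
        using powr_quadratic_unbounded[of "inv_exponent r - \<rho>" \<delta> C] r by auto
    qed (use r in simp)
    show "max_const p q r m M < \<infinity>" if r: "q \<le> r \<and> (inv_exponent r < \<rho> \<or> inv_exponent r \<le> \<rho> \<and> \<delta> < - 1)" for r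
    proof (rule max_const_less_top)
      have r1: "1 \<le> r" using r q by (auto intro: order_trans)
      show "\<exists>C\<ge>0. \<forall>f\<in>lorentz_space M p q.
        lorentz_norm_enn M p r (centered_max m M f) \<le> ennreal C * lorentz_norm M p q f"
      proof (cases r)
        case (real r')
        then have r': "1 \<le> r'" using r1 by (simp add: one_ereal_def)
        have "(2 ^ k * a k) powr (r' / p) * N k = 2 powr ((r' / p + r' * \<delta>) * k - (r' * \<rho> - 1) * (real k)\<^sup>2)" for k
        proof -
          have "2 ^ k * a k = 2 powr (k + p * (\<delta> * k - \<rho> * (real k)\<^sup>2))"
            by (simp add: a_def powr_add powr_realpow)
          moreover have "(k + p * (\<delta> * k - \<rho> * (real k)\<^sup>2)) * (r' / p) + (real k)\<^sup>2 = (r' / p + r' * \<delta>) * k - (r' * \<rho> - 1) * (real k)\<^sup>2"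
            using p by (simp add: field_simps)
          ultimately show ?thesis by (simp add: N_real powr_powr powr_add[symmetric])
        qed
        moreover have "0 < r' * \<rho> - 1 \<or> 0 \<le> r' * \<rho> - 1 \<and> r' / p + r' * \<delta> < 0"
        proof -
          have "inv_exponent r = 1 / r'" using real by (simp add: inv_exponent_def)
          then have "1 / r' < \<rho> \<or> 1 / r' \<le> \<rho> \<and> \<delta> < - 1" using r by simp
          \<comment> \<open>The summand \<open>r' / p\<close> is the effect of the weights
            \<open>2 ^ k\<close>. As \<open>p \<ge> 1\<close>, it is at most \<open>r'\<close>,
            which \<open>\<delta> < - 1\<close> outweighs for every admissible
            \<open>p\<close>.\<close>
          moreover have "r' / p + r' * \<delta> < 0" if "\<delta> < - 1"
          proof -
            have "r' / p \<le> r'" using p r' by (simp add: divide_le_eq mult_le_cancel_left1)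
            moreover have "r' * \<delta> < r' * (- 1)" using that r' by (intro mult_strict_left_mono) auto
            ultimately show ?thesis by linarith
          qed
          ultimately show ?thesis using r' by (auto simp: divide_less_eq divide_le_eq mult.commute)
        qed
        ultimately have "summable (\<lambda>k. (2 ^ k * a k) powr (r' / p) * N k)"
          using summable_powr_quadratic by simp
        then show ?thesis
          using centered_max_bounded_real[OF pq, of r'] r real by simp
      next
        case PInf
        \<comment> \<open>If infinity is itself the critical exponent, then
          \<open>\<rho> = 0\<close> and \<open>a\<close> is a geometric sequence, decaying because
          \<open>\<delta>\<close> is negative.\<close>
        have "a = (\<lambda>k. 2 powr ((p * \<delta>) * k - (p * \<rho>) * (real k)\<^sup>2))"
          by (simp add: fun_eq_iff a_def algebra_simps)
        moreover have "0 < p * \<rho> \<or> 0 \<le> p * \<rho> \<and> p * \<delta> < 0"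
          using r PInf p by (auto simp: inv_exponent_def mult_less_0_iff zero_less_mult_iff)
        ultimately have "summable a"
          using summable_powr_quadratic[of "p * \<rho>" "p * \<delta>"] by simp
        then show ?thesis unfolding PInf by (rule centered_max_bounded_infinity[OF pq])
      qed (use r1 in simp)
    qed
  qed
qed

section \<open>Choice of parameters for the two endpoint behaviours\<close>

lemma inv_exponent_mono: "1 \<le> r \<Longrightarrow> r \<le> r' \<Longrightarrow> inv_exponent r' \<le> inv_exponent r"
  by (cases r; cases r') (auto simp: inv_exponent_def one_ereal_def intro!: divide_left_mono)

lemma inv_exponent_strict_mono: "1 \<le> r \<Longrightarrow> r < r' \<Longrightarrow> inv_exponent r' < inv_exponent r"
  by (cases r; cases r') (auto simp: inv_exponent_def one_ereal_def intro!: divide_strict_left_mono)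

theorem theorem4p2p1:
  fixes p0 :: real and q0 r0 :: ereal
  assumes "admissible p0 q0 r0"
  shows "(\<exists>(m::real metric) M. mms m M \<and> \<not> doubling m M \<and>
            (\<forall>r. q0 \<le> r \<and> r \<le> r0 \<longrightarrow> max_const p0 q0 r m M = \<infinity>) \<and>
            (\<forall>r. r0 < r \<longrightarrow> max_const p0 q0 r m M < \<infinity>))
       \<and> (\<exists>(m::real metric) M. mms m M \<and> \<not> doubling m M \<and>
            (\<forall>r. q0 \<le> r \<and> r < r0 \<longrightarrow> max_const p0 q0 r m M = \<infinity>) \<and>
            (\<forall>r. r0 \<le> r \<longrightarrow> max_const p0 q0 r m M < \<infinity>))"
proof -
  have pq: "p0 = 1 \<and> q0 = 1 \<or> 1 < p0 \<and> 1 \<le> q0" and q: "1 \<le> q0" and r0: "q0 \<le> r0"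
    using assms by (auto simp: admissible_def)
  have r01: "1 \<le> r0" using q r0 by (rule order_trans)
  note mono = inv_exponent_mono inv_exponent_strict_mono
  have ge1: "1 \<le> r" if "q0 \<le> r" for r using q that by (rule order_trans)
  show ?thesis
  proof (rule conjI)
    \<comment> \<open>With \<open>\<delta> = 1\<close> the test quantity still grows like
      \<open>2 ^ k\<close> at \<open>r0\<close>, so the constant is already infinite there.\<close>
    obtain m :: "real metric" and M where 1: "mms m M" "\<not> doubling m M"
      and 2: "\<forall>r. 1 \<le> r \<and> (inv_exponent r0 < inv_exponent r \<or> inv_exponent r0 \<le> inv_exponent r \<and> 0 < (1::real)) \<longrightarrow> max_const p0 q0 r m M = \<infinity>"
      and 3: "\<forall>r. q0 \<le> r \<and> (inv_exponent r < inv_exponent r0 \<or> inv_exponent r \<le> inv_exponent r0 \<and> (1::real) < - 1) \<longrightarrow> max_const p0 q0 r m M < \<infinity>"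
      using ex_space[OF pq, of "inv_exponent r0" 1] by blast
    have "max_const p0 q0 r m M = \<infinity>" if "q0 \<le> r" "r \<le> r0" for r
      using 2 ge1[OF that(1)] mono(1)[OF ge1[OF that(1)] that(2)] by simp
    moreover have "max_const p0 q0 r m M < \<infinity>" if "r0 < r" for r
      using 3 r0 that mono(2)[OF r01 that] by auto
    ultimately show "\<exists>(m::real metric) M. mms m M \<and> \<not> doubling m M \<and>
            (\<forall>r. q0 \<le> r \<and> r \<le> r0 \<longrightarrow> max_const p0 q0 r m M = \<infinity>) \<and>
            (\<forall>r. r0 < r \<longrightarrow> max_const p0 q0 r m M < \<infinity>)"
      using 1 by blast
  next
    \<comment> \<open>With \<open>\<delta> = - 2\<close>, below the threshold \<open>- 1\<close>,
      the sources remain summable at \<open>r0\<close> itself.\<close>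
    obtain m :: "real metric" and M where 1: "mms m M" "\<not> doubling m M"
      and 2: "\<forall>r. 1 \<le> r \<and> (inv_exponent r0 < inv_exponent r \<or> inv_exponent r0 \<le> inv_exponent r \<and> 0 < (- 2::real)) \<longrightarrow> max_const p0 q0 r m M = \<infinity>"
      and 3: "\<forall>r. q0 \<le> r \<and> (inv_exponent r < inv_exponent r0 \<or> inv_exponent r \<le> inv_exponent r0 \<and> (- 2::real) < - 1) \<longrightarrow> max_const p0 q0 r m M < \<infinity>"
      using ex_space[OF pq, of "inv_exponent r0" "- 2"] by blast
    have "max_const p0 q0 r m M = \<infinity>" if "q0 \<le> r" "r < r0" for r
      using 2 ge1[OF that(1)] mono(2)[OF ge1[OF that(1)] that(2)] by simp
    moreover have "max_const p0 q0 r m M < \<infinity>" if "r0 \<le> r" for r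
      using 3 order_trans[OF r0 that] mono(1)[OF r01 that] by auto
    ultimately show "\<exists>(m::real metric) M. mms m M \<and> \<not> doubling m M \<and>
            (\<forall>r. q0 \<le> r \<and> r < r0 \<longrightarrow> max_const p0 q0 r m M = \<infinity>) \<and>
            (\<forall>r. r0 \<le> r \<longrightarrow> max_const p0 q0 r m M < \<infinity>)"
      using 1 by blast
  qed
qed

end
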